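(* Let $1<p<\infty$ and let $T:B_p\to B_p$ be a nonzero bounded linear operator on the Besov space $B_p$. Then $T$ is almost multiplicative if and only if $T$ is a composition operator.
   Context: $\mathbb{D}$ is the open unit disc in $\mathbb{C}$ and $dA=\frac1\pi\,dx\,dy$ is normalized area measure on $\mathbb{D}$. For $1<p<\infty$, the Besov space $B_p$ is the space of analytic functions $f$ on $\mathbb{D}$ with $\int_{\mathbb{D}}(1-|z|^2)^{p-2}|f'(z)|^p\,dA<\infty$, with norm $\|f\|_{B_p}=|f(0)|+\left(\int_{\mathbb{D}}(1-|z|^2)^{p-2}|f'(z)|^p\,dA\right)^{1/p}$. A bounded linear operator $T$ on a space $\mathcal{A}$ of analytic functions on $\mathbb{D}$ is almost multiplicative if $T(fg)=T(f)T(g)$ whenever $f,g,fg\in\mathcal{A}$ (pointwise product). $T$ is a composition operator on $\mathcal{A}$ if there is an analytic map $\varphi:\mathbb{D}\to\mathbb{D}$ such that $Tf=f\circ\varphi$ for all $f\in\mathcal{A}$. *)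

theory Defs
  imports "HOL-Complex_Analysis.Complex_Analysis"
begin

abbreviation unit_disc :: "complex set" where
  "unit_disc \<equiv> ball 0 1"

text \<open>
  HOL functions are total, so an analytic function on the disc is represented by its unique
  extension by zero. Equality of representatives is then equality on the disc, and pointwise sums,
  scalar multiples and products of representatives are again representatives.
\<close>

definition disc_analytic :: "(complex \<Rightarrow> complex) set" where
  "disc_analytic = {f. f holomorphic_on unit_disc \<and> (\<forall>z. z \<notin> unit_disc \<longrightarrow> f z = 0)}"

definition disc_area :: "complex measure" where
  "disc_area = density lborel (\<lambda>z. ennreal (1 / pi) * indicator unit_disc z)"

definition besov_integrand :: "real \<Rightarrow> (complex \<Rightarrow> complex) \<Rightarrow> complex \<Rightarrow> real" where
  "besov_integrand p f z = (1 - (cmod z)\<^sup>2) powr (p - 2) * cmod (deriv f z) powr p"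

definition besov_space :: "real \<Rightarrow> (complex \<Rightarrow> complex) set" where
  "besov_space p = {f \<in> disc_analytic. (\<integral>\<^sup>+ z. ennreal (besov_integrand p f z) \<partial>disc_area) < \<infinity>}"

definition besov_norm :: "real \<Rightarrow> (complex \<Rightarrow> complex) \<Rightarrow> real" where
  "besov_norm p f = cmod (f 0) + (\<integral>z. besov_integrand p f z \<partial>disc_area) powr (1 / p)"

text \<open>
  Operators are HOL functions of which only the values on the space \<open>A\<close> matter; \<open>N\<close> is the norm
  of \<open>A\<close>.
\<close>

definition bounded_linear_operator_on ::
  "(complex \<Rightarrow> complex) set \<Rightarrow> ((complex \<Rightarrow> complex) \<Rightarrow> real) \<Rightarrow>
    ((complex \<Rightarrow> complex) \<Rightarrow> (complex \<Rightarrow> complex)) \<Rightarrow> bool" where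
  "bounded_linear_operator_on A N T \<longleftrightarrow>
     T \<in> A \<rightarrow> A \<and>
     (\<forall>f\<in>A. \<forall>g\<in>A. T (\<lambda>z. f z + g z) = (\<lambda>z. T f z + T g z)) \<and>
     (\<forall>c. \<forall>f\<in>A. T (\<lambda>z. c * f z) = (\<lambda>z. c * T f z)) \<and>
     (\<exists>C. \<forall>f\<in>A. N (T f) \<le> C * N f)"

definition almost_multiplicative ::
  "(complex \<Rightarrow> complex) set \<Rightarrow> ((complex \<Rightarrow> complex) \<Rightarrow> (complex \<Rightarrow> complex)) \<Rightarrow> bool" where
  "almost_multiplicative A T \<longleftrightarrow>
     (\<forall>f\<in>A. \<forall>g\<in>A. (\<lambda>z. f z * g z) \<in> A \<longrightarrow> T (\<lambda>z. f z * g z) = (\<lambda>z. T f z * T g z))"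

definition composition_operator ::
  "(complex \<Rightarrow> complex) set \<Rightarrow> ((complex \<Rightarrow> complex) \<Rightarrow> (complex \<Rightarrow> complex)) \<Rightarrow> bool" where
  "composition_operator A T \<longleftrightarrow>
     (\<exists>\<phi>. \<phi> holomorphic_on unit_disc \<and> \<phi> \<in> unit_disc \<rightarrow> unit_disc \<and>
        (\<forall>f\<in>A. \<forall>z\<in>unit_disc. T f z = f (\<phi> z)))"

end

theory Submission
  imports Defs
begin

text \<open>
  Only the forward direction has content. Multiplicativity forces \<open>T 1 = 1\<close>; put \<open>\<phi> = T id\<close>. If
  \<open>f - c = (id - a) g\<close> in \<open>B_p\<close>, then \<open>T f - c = (\<phi> - a) (T g)\<close>, so \<open>T f\<close> takes the value \<open>c\<close>
  wherever \<open>\<phi>\<close> takes the value \<open>a\<close>. With \<open>g = 1 / (id - a)\<close>, \<open>f = 1\<close>, \<open>c = 0\<close> this excludes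
  \<open>|a| > 1\<close>; with \<open>g\<close> the difference quotient of \<open>f\<close> at \<open>a\<close> it gives \<open>T f = f \<circ> \<phi>\<close> without
  appealing to density of polynomials, since \<open>B_p\<close> is closed under difference quotients at points
  of the disc. By the maximum principle it remains to exclude that \<open>\<phi>\<close> is a constant \<open>w\<close> of modulus
  one. This is where boundedness enters: \<open>f_e(z) = - log (1 + e - cnj w z)\<close> takes the
  value \<open>log (1/e)\<close> at \<open>w\<close>, whereas its norm is only \<open>O(log (1/e) powr (1/p))\<close>.
\<close>

section \<open>Lebesgue measure on the complex plane and the disc\<close>

lemma measurable_Complex [measurable]:
  "(\<lambda>(x, y). Complex x y) \<in> (borel \<Otimes>\<^sub>M borel) \<rightarrow>\<^sub>M borel"
  unfolding borel_prod case_prod_beta' Complex_eq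
  by (intro borel_measurable_continuous_onI continuous_intros)

text \<open>Lebesgue measure is determined by its values on boxes, and \<open>Complex\<close> pulls
  an open box back to a product of two open intervals. This gives access to Tonelli's theorem on the
  plane.\<close>

lemma lborel_complex_eq_distr:
  "(lborel :: complex measure) = distr (lborel \<Otimes>\<^sub>M lborel) borel (\<lambda>(x, y). Complex x y)"
proof (rule lborel_eqI)
  fix l u :: complex
  assume le: "\<And>b. b \<in> Basis \<Longrightarrow> l \<bullet> b \<le> u \<bullet> b"
  have "(\<lambda>(x, y). Complex x y) -` box l u = {Re l<..<Re u} \<times> {Im l<..<Im u}"
    by (auto simp: box_def Basis_complex_def)
  moreover have "Re l \<le> Re u" "Im l \<le> Im u"
    using le[of 1] le[of \<i>] by (auto simp: Basis_complex_def)
  ultimately show "emeasure (distr (lborel \<Otimes>\<^sub>M lborel) borel (\<lambda>(x, y). Complex x y)) (box l u)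
      = ennreal (\<Prod>b\<in>Basis. (u - l) \<bullet> b)"
    by (subst emeasure_distr)
       (auto simp: space_pair_measure lborel.emeasure_pair_measure_Times Basis_complex_def ennreal_mult)
qed simp

text \<open>Tonelli's theorem in both orders: each of the two kinds of shear needs its own order,
  and the estimate of the logarithmic test functions slices the disc horizontally.\<close>

lemma nn_integral_lborel_complex:
  fixes f :: "complex \<Rightarrow> ennreal"
  assumes [measurable]: "f \<in> borel_measurable borel"
  shows "(\<integral>\<^sup>+z. f z \<partial>lborel) = (\<integral>\<^sup>+y. \<integral>\<^sup>+x. f (Complex x y) \<partial>lborel \<partial>lborel)" (is ?A)
    and "(\<integral>\<^sup>+z. f z \<partial>lborel) = (\<integral>\<^sup>+x. \<integral>\<^sup>+y. f (Complex x y) \<partial>lborel \<partial>lborel)" (is ?B)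
proof -
  have eq: "(\<integral>\<^sup>+z. f z \<partial>lborel) = (\<integral>\<^sup>+v. f (Complex (fst v) (snd v)) \<partial>(lborel \<Otimes>\<^sub>M lborel))"
    by (subst lborel_complex_eq_distr, subst nn_integral_distr) (auto simp: case_prod_beta')
  have m: "(\<lambda>v. f (Complex (fst v) (snd v))) \<in> borel_measurable (lborel \<Otimes>\<^sub>M lborel)"
    using measurable_compose[OF measurable_Complex assms] by (simp add: case_prod_beta')
  show ?B
    unfolding eq using lborel.nn_integral_fst[OF m] by simp
  show ?A
    unfolding eq using lborel_pair.nn_integral_snd[of "\<lambda>v. f (Complex (fst v) (snd v))"] m
    by (simp add: case_prod_beta')
qed

lemma nn_integral_lborel_shift:
  fixes f :: "real \<Rightarrow> ennreal"
  assumes [measurable]: "f \<in> borel_measurable borel"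
  shows "(\<integral>\<^sup>+x. f (x + a) \<partial>lborel) = (\<integral>\<^sup>+x. f x \<partial>lborel)"
  using nn_integral_real_affine[of f 1 a] assms by (simp add: add.commute)

text \<open>The first shear translates every horizontal line, the second every vertical line. With
  the matching order of integration the inner integral is therefore unchanged.\<close>

lemma nn_integral_lborel_complex_shear:
  fixes f :: "complex \<Rightarrow> ennreal"
  assumes [measurable]: "f \<in> borel_measurable borel"
  shows "(\<integral>\<^sup>+z. f (z + of_real (a * Im z)) \<partial>lborel) = (\<integral>\<^sup>+z. f z \<partial>lborel)" (is ?A)
    and "(\<integral>\<^sup>+z. f (z + \<i> * of_real (a * Re z)) \<partial>lborel) = (\<integral>\<^sup>+z. f z \<partial>lborel)" (is ?B)
proof -
  have m: "(\<lambda>x. f (Complex x y)) \<in> borel_measurable borel"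
          "(\<lambda>y. f (Complex x y)) \<in> borel_measurable borel" for x y
    by (simp_all add: Complex_eq)
  have e: "Complex x y + of_real (a * y) = Complex (x + a * y) y"
          "Complex x y + \<i> * of_real (a * x) = Complex x (y + a * x)" for x y
    by (simp_all add: complex_eq_iff)
  show ?A
    by (simp add: nn_integral_lborel_complex(1) e nn_integral_lborel_shift[OF m(1)]
             del: of_real_mult)
  show ?B
    by (simp add: nn_integral_lborel_complex(2) e nn_integral_lborel_shift[OF m(2)]
             del: of_real_mult)
qed

lemma nn_integral_lborel_complex_rotate:
  fixes f :: "complex \<Rightarrow> ennreal"
  assumes [measurable]: "f \<in> borel_measurable borel" and c: "cmod c = 1"
  shows "(\<integral>\<^sup>+z. f (c * z) \<partial>lborel) = (\<integral>\<^sup>+z. f z \<partial>lborel)"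
proof -
  \<comment> \<open>a rotation by an angle \<open>\<theta> \<noteq> \<pi>\<close> is a product of three shears, with parameters
    \<open>- tan (\<theta>/2)\<close>, \<open>sin \<theta>\<close>, \<open>- tan (\<theta>/2)\<close>\<close>
  have main: "(\<integral>\<^sup>+z. f (d * z) \<partial>lborel) = (\<integral>\<^sup>+z. f z \<partial>lborel)"
    if [measurable]: "f \<in> borel_measurable borel" and d: "cmod d = 1" "d \<noteq> -1"
    for d and f :: "complex \<Rightarrow> ennreal"
  proof -
    have n: "(Re d)\<^sup>2 + (Im d)\<^sup>2 = 1"
      using d by (simp add: cmod_def)
    have r: "1 + Re d \<noteq> 0"
    proof
      assume "1 + Re d = 0"
      then have "Re d = -1" by simp
      with n have "Im d = 0" by simp
      with \<open>Re d = -1\<close> d(2) show False by (simp add: complex_eq_iff)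
    qed
    define t where "t = - Im d / (1 + Re d)"
    define S where "S = (\<lambda>a z. z + complex_of_real (a * Im z))"
    define R where "R = (\<lambda>a z. z + \<i> * complex_of_real (a * Re z))"
    have [measurable]: "S a \<in> borel_measurable borel" "R a \<in> borel_measurable borel" for a
      by (simp_all add: S_def R_def)
    have s1: "(\<integral>\<^sup>+z. g (S a z) \<partial>lborel) = (\<integral>\<^sup>+z. g z \<partial>lborel)"
      if "g \<in> borel_measurable borel" for g :: "complex \<Rightarrow> ennreal" and a
      using nn_integral_lborel_complex_shear(1)[OF that] by (simp add: S_def)
    have s2: "(\<integral>\<^sup>+z. g (R a z) \<partial>lborel) = (\<integral>\<^sup>+z. g z \<partial>lborel)"
      if "g \<in> borel_measurable borel" for g :: "complex \<Rightarrow> ennreal" and a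
      using nn_integral_lborel_complex_shear(2)[OF that] by (simp add: R_def)
    have a1: "1 + t * Im d = Re d"
      using r n unfolding t_def by (simp add: field_simps power2_eq_square)
    have a2: "t * (1 + Re d) = - Im d"
      using r by (simp add: t_def)
    have "S t (R (Im d) (S t z)) = d * z" for z
    proof (rule complex_eqI)
      have "Re (S t (R (Im d) (S t z))) = (1 + t * Im d) * Re z + t * (1 + (1 + t * Im d)) * Im z"
        by (simp add: S_def R_def algebra_simps)
      also have "\<dots> = Re (d * z)"
        unfolding a1 a2 by simp
      finally show "Re (S t (R (Im d) (S t z))) = Re (d * z)" .
      have "Im (S t (R (Im d) (S t z))) = Im d * Re z + (1 + t * Im d) * Im z"
        by (simp add: S_def R_def algebra_simps)
      also have "\<dots> = Im (d * z)"
        unfolding a1 by simp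
      finally show "Im (S t (R (Im d) (S t z))) = Im (d * z)" .
    qed
    then have "(\<integral>\<^sup>+z. f (d * z) \<partial>lborel) = (\<integral>\<^sup>+z. f (S t (R (Im d) (S t z))) \<partial>lborel)"
      by simp
    also have "\<dots> = (\<integral>\<^sup>+z. f z \<partial>lborel)"
      using s1[of "\<lambda>z. f (S t (R (Im d) z))" t] s2[of "\<lambda>z. f (S t z)" "Im d"] s1[of f t]
      by simp
    finally show ?thesis .
  qed
  show ?thesis
  \<comment> \<open>For the half turn \<open>tan (\<theta>/2)\<close> is infinite, so it is
    performed as two quarter turns.\<close>
  proof (cases "c = -1")
    case True
    have [measurable]: "(\<lambda>z. f (\<i> * z)) \<in> borel_measurable borel"
      by simp
    have "(\<integral>\<^sup>+z. f (c * z) \<partial>lborel) = (\<integral>\<^sup>+z. f (\<i> * (\<i> * z)) \<partial>lborel)"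
      by (simp add: True mult.assoc[symmetric])
    also have "\<dots> = (\<integral>\<^sup>+z. f z \<partial>lborel)"
      using main[of "\<lambda>z. f (\<i> * z)" \<i>] main[of f \<i>] by (simp add: complex_eq_iff)
    finally show ?thesis .
  next
    case False
    with main c show ?thesis by simp
  qed
qed

section \<open>The normalized area measure of the disc\<close>

lemma unit_disc_in_borel [measurable]: "unit_disc \<in> sets borel"
  by simp

lemma sets_disc_area [measurable_cong, simp]: "sets disc_area = sets borel"
  by (simp add: disc_area_def)

lemma space_disc_area [simp]: "space disc_area = UNIV"
  by (simp add: disc_area_def)

lemma nn_integral_disc_area:
  assumes [measurable]: "f \<in> borel_measurable borel"
  shows "(\<integral>\<^sup>+z. f z \<partial>disc_area) = ennreal (1 / pi) * (\<integral>\<^sup>+z. f z * indicator unit_disc z \<partial>lborel)"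
  unfolding disc_area_def
  by (subst nn_integral_density) (simp_all add: nn_integral_cmult[symmetric] mult_ac)

lemma emeasure_disc_area:
  assumes [measurable]: "A \<in> sets borel"
  shows "emeasure disc_area A = ennreal (1 / pi) * emeasure lborel (A \<inter> unit_disc)"
  using nn_integral_disc_area[of "indicator A"] by (simp add: indicator_inter_arith[symmetric])

lemma AE_disc_area: "AE z in disc_area. z \<in> unit_disc"
  unfolding disc_area_def by (subst AE_density) (auto intro!: AE_I2 simp: indicator_def)

lemma nn_integral_disc_area_rotate:
  fixes f :: "complex \<Rightarrow> ennreal"
  assumes [measurable]: "f \<in> borel_measurable borel" and c: "cmod c = 1"
  shows "(\<integral>\<^sup>+z. f (c * z) \<partial>disc_area) = (\<integral>\<^sup>+z. f z \<partial>disc_area)"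
proof -
  have "indicator unit_disc z = (indicator unit_disc (c * z) :: ennreal)" for z
    using c by (simp add: indicator_def norm_mult)
  then show ?thesis
    using nn_integral_lborel_complex_rotate[of "\<lambda>z. f z * indicator unit_disc z" c, OF _ c]
    by (simp add: nn_integral_disc_area)
qed

text \<open>The points of the disc with \<open>1 - |z|^2 > x\<close> form a disc of squared radius
  \<open>1 - max 0 x\<close> if \<open>x < 1\<close>, and none exist otherwise. So
  \<open>1 - |z|^2\<close> is uniformly distributed on \<open>[0, 1]\<close>, which replaces polar
  coordinates for radial integrands.\<close>

lemma distr_disc_area:
  "distr disc_area borel (\<lambda>z. 1 - (cmod z)\<^sup>2) = density lborel (indicator {0..1})"
proof (rule measure_eqI_lessThan)
  fix x :: real
  have meas: "(\<lambda>z. 1 - (cmod z)\<^sup>2) \<in> borel_measurable borel" by simp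
  have [measurable]: "(\<lambda>z. 1 - (cmod z)\<^sup>2) -` {x<..} \<in> sets borel"
    using measurable_sets[OF meas, of "{x<..}"] by simp
  define r where "r = sqrt (1 - max 0 x)"
  have "(\<lambda>z. 1 - (cmod z)\<^sup>2) -` {x<..} \<inter> unit_disc = (if x < 1 then ball 0 r else {})"
  proof (cases "x < 1")
    case True
    have "1 - (cmod z)\<^sup>2 > x \<and> cmod z < 1 \<longleftrightarrow> cmod z < r" for z
    proof -
      have "cmod z < r \<longleftrightarrow> (cmod z)\<^sup>2 < 1 - max 0 x"
        unfolding r_def using True real_less_lsqrt[of "cmod z" "1 - max 0 x"]
          real_less_rsqrt[of "cmod z" "1 - max 0 x"] real_sqrt_less_iff[of "(cmod z)\<^sup>2" "1 - max 0 x"]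
        by auto
      moreover have "cmod z < 1 \<longleftrightarrow> (cmod z)\<^sup>2 < 1"
        by (simp add: power_less_one_iff abs_square_less_1)
      ultimately show ?thesis by auto
    qed
    then show ?thesis using True by (simp add: set_eq_iff)
  next
    case False
    then have "\<not> 1 - (cmod z)\<^sup>2 > x" for z
      using zero_le_power2[of "cmod z"] by linarith
    then show ?thesis using False by auto
  qed
  moreover have "emeasure (distr disc_area borel (\<lambda>z. 1 - (cmod z)\<^sup>2)) {x<..}
      = ennreal (1 / pi) * emeasure lborel ((\<lambda>z. 1 - (cmod z)\<^sup>2) -` {x<..} \<inter> unit_disc)"
    by (subst emeasure_distr) (simp_all add: emeasure_disc_area)
  ultimately have e: "emeasure (distr disc_area borel (\<lambda>z. 1 - (cmod z)\<^sup>2)) {x<..}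
      = (if x < 1 then ennreal (1 - max 0 x) else 0)"
    by (auto simp: emeasure_ball r_def unit_ball_vol_2 ennreal_mult[symmetric])
  have "{x<..} \<inter> {0..1} = (if x < 1 then if x < 0 then {0..1} else {x<..1} else {})"
    by auto
  moreover have "emeasure (density lborel (indicator {0..1})) {x<..} = emeasure lborel ({x<..} \<inter> {0..1})"
    by (subst emeasure_density) (auto simp: nn_integral_indicator[symmetric] indicator_inter_arith mult.commute
        simp del: nn_integral_indicator)
  ultimately show "emeasure (distr disc_area borel (\<lambda>z. 1 - (cmod z)\<^sup>2)) {x<..} =
      emeasure (density lborel (indicator {0..1})) {x<..}"
    unfolding e by auto
  show "emeasure (distr disc_area borel (\<lambda>z. 1 - (cmod z)\<^sup>2)) {x<..} < \<infinity>"
    unfolding e by auto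
qed simp_all

text \<open>By the uniform distribution of \<open>1 - |z|^2\<close> this is the integral of
  \<open>t powr s\<close> over \<open>[0, 1]\<close>. For \<open>s = p - 2\<close> it says that the
  Besov weight is integrable, which is where \<open>p > 1\<close> enters.\<close>

lemma nn_integral_disc_area_powr:
  assumes "s > -1"
  shows "(\<integral>\<^sup>+z. ennreal ((1 - (cmod z)\<^sup>2) powr s) \<partial>disc_area) = ennreal (1 / (s + 1))"
proof -
  have "(\<integral>\<^sup>+z. ennreal ((1 - (cmod z)\<^sup>2) powr s) \<partial>disc_area)
      = (\<integral>\<^sup>+t. ennreal (t powr s) \<partial>distr disc_area borel (\<lambda>z. 1 - (cmod z)\<^sup>2))"
    by (subst nn_integral_distr) auto
  also have "\<dots> = (\<integral>\<^sup>+t. ennreal (t powr s) * indicator {0..1} t \<partial>lborel)"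
    unfolding distr_disc_area by (subst nn_integral_density) (auto simp: mult.commute)
  also have "\<dots> = ennreal (1 / (s + 1))"
    using has_integral_powr_from_0[of s 1] assms
    by (subst nn_integral_has_integral_lebesgue') (auto)
  finally show ?thesis .
qed

section \<open>Mean value inequalities\<close>

lemma borel_measurable_norm_indicator:
  fixes f :: "complex \<Rightarrow> complex"
  assumes "open S" "continuous_on S f"
  shows "(\<lambda>z. ennreal (cmod (f z)) * indicator S z) \<in> borel_measurable borel"
proof -
  have [measurable]: "(\<lambda>z. indicator S z *\<^sub>R f z) \<in> borel_measurable borel"
    using assms by (intro borel_measurable_continuous_on_indicator) auto
  have "(\<lambda>z. ennreal (cmod (indicator S z *\<^sub>R f z))) \<in> borel_measurable borel"
    by measurable
  also have "(\<lambda>z. ennreal (cmod (indicator S z *\<^sub>R f z))) = (\<lambda>z. ennreal (cmod (f z)) * indicator S z)"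
    by (auto simp: indicator_def)
  finally show ?thesis .
qed

text \<open>Cauchy's formula at 0 for \<open>u \<mapsto> f (z + u * \<zeta>)\<close> on the unit
  circle. The circle is described by a point \<zeta> and not by a radius, so that the inequality can
  be integrated over \<zeta>; the degenerate case \<open>\<zeta> = 0\<close> is covered as
  well.\<close>

lemma circle_mean_value_le:
  assumes holf: "f holomorphic_on cball z (cmod \<zeta>)"
  shows "ennreal (cmod (f z))
    \<le> (\<integral>\<^sup>+t. ennreal (cmod (f (z + exp (2 * of_real pi * \<i> * of_real t) * \<zeta>))) * indicator {0..1} t \<partial>lborel)"
proof -
  define e where "e = (\<lambda>t. exp (2 * complex_of_real pi * \<i> * complex_of_real t))"
  define g where "g = (\<lambda>u. f (z + u * \<zeta>))"
  define c where "c = 2 * complex_of_real pi * \<i>"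
  have ne: "cmod (e t) = 1" for t
    by (simp add: e_def)
  have "(f \<circ> (\<lambda>u. z + u * \<zeta>)) holomorphic_on cball 0 1"
  proof (rule holomorphic_on_compose_gen[OF _ holf])
    show "(\<lambda>u. z + u * \<zeta>) ` cball 0 1 \<subseteq> cball z (cmod \<zeta>)"
      by (auto simp: dist_norm norm_mult mult_left_le_one_le)
  qed (intro holomorphic_intros)
  then have hg: "g holomorphic_on cball 0 1"
    by (simp add: g_def o_def)
  have "((\<lambda>u. g u / (u - 0)) has_contour_integral (2 * of_real pi * \<i> * g 0)) (circlepath 0 1)"
    by (rule Cauchy_integral_circlepath_simple[OF hg]) simp
  then have "((\<lambda>t. g (circlepath 0 1 t) / circlepath 0 1 t *
      vector_derivative (circlepath 0 1) (at t within {0..1})) has_integral (2 * of_real pi * \<i> * g 0)) {0..1}"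
    by (simp add: has_contour_integral_def)
  then have "((\<lambda>t. c * g (e t)) has_integral (c * g 0)) {0..1}"
    unfolding c_def[symmetric]
    by (rule has_integral_eq[rotated]) (simp add: vector_derivative_circlepath01, simp add: circlepath e_def c_def)
  moreover have "c \<noteq> 0" by (simp add: c_def)
  ultimately have int: "((\<lambda>t. g (e t)) has_integral g 0) {0..1}"
    using has_integral_mult_right[of "\<lambda>t. c * g (e t)" "c * g 0" "{0..1}" "inverse c"]
    by (simp add: mult.assoc[symmetric])
  have "continuous_on {0..1} e"
    unfolding e_def by (intro continuous_intros)
  then have "continuous_on {0..1} (\<lambda>t. g (e t))"
    by (rule continuous_on_compose2[OF holomorphic_on_imp_continuous_on[OF hg]]) (simp add: image_subset_iff ne)
  then have "continuous_on {0..1} (\<lambda>t. cmod (g (e t)))"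
    by (intro continuous_intros)
  then have ni: "(\<lambda>t. cmod (g (e t))) integrable_on {0..1}"
    by (rule integrable_continuous_interval)
  have le: "cmod (g 0) \<le> integral {0..1} (\<lambda>t. cmod (g (e t)))"
    using integral_norm_bound_integral[OF _ ni, of "\<lambda>t. g (e t)"] int
    by (simp add: has_integral_iff)
  have "ennreal (cmod (g 0)) \<le> ennreal (integral {0..1} (\<lambda>t. cmod (g (e t))))"
    by (rule ennreal_leI[OF le])
  also have "\<dots> = (\<integral>\<^sup>+t. ennreal (cmod (g (e t))) * indicator {0..1} t \<partial>lborel)"
    by (rule nn_integral_has_integral_lebesgue'[symmetric]) (use ni in \<open>auto simp: integrable_integral\<close>)
  finally show ?thesis
    by (simp add: g_def e_def)
qed

text \<open>The circle inequality is integrated over all \<zeta> in the disc. After exchanging the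
  integrals, rotation invariance makes the inner integral over \<zeta> the same for every angle
  \<open>t\<close>, and \<open>t\<close> ranges over an interval of length one.\<close>

lemma area_mean_value_le:
  assumes holf: "f holomorphic_on ball z \<rho>"
  shows "ennreal (cmod (f z)) * emeasure lborel (ball z \<rho>)
    \<le> (\<integral>\<^sup>+\<zeta>. ennreal (cmod (f \<zeta>)) * indicator (ball z \<rho>) \<zeta> \<partial>lborel)"
proof -
  define F where "F = (\<lambda>\<zeta>. ennreal (cmod (f (z + \<zeta>))) * indicator (ball 0 \<rho>) \<zeta>)"
  define e where "e = (\<lambda>t. exp (2 * complex_of_real pi * \<i> * complex_of_real t))"
  have ne: "cmod (e t) = 1" for t
    by (simp add: e_def)
  have ind: "indicator (ball z \<rho>) (z + \<zeta>) = indicator (ball 0 \<rho>) \<zeta>" for \<zeta>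
    by (simp add: indicator_def dist_norm)
  have H [measurable]: "(\<lambda>\<zeta>. ennreal (cmod (f \<zeta>)) * indicator (ball z \<rho>) \<zeta>) \<in> borel_measurable borel"
    using holomorphic_on_imp_continuous_on[OF holf] by (intro borel_measurable_norm_indicator) auto
  have "F = (\<lambda>\<zeta>. ennreal (cmod (f (z + \<zeta>))) * indicator (ball z \<rho>) (z + \<zeta>))"
    by (simp add: F_def ind)
  also have "\<dots> \<in> borel_measurable borel"
    by (rule measurable_compose[OF _ H]) simp
  finally have [measurable]: "F \<in> borel_measurable borel" .
  have [measurable]: "e \<in> borel_measurable borel"
    unfolding e_def by (intro borel_measurable_continuous_onI continuous_intros)
  have shift: "(\<integral>\<^sup>+\<zeta>. ennreal (cmod (f \<zeta>)) * indicator (ball z \<rho>) \<zeta> \<partial>lborel) = (\<integral>\<^sup>+\<zeta>. F \<zeta> \<partial>lborel)"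
    by (subst lborel_distr_plus[symmetric, of z], subst nn_integral_distr) (auto simp: F_def ind)
  have "ennreal (cmod (f z)) * emeasure lborel (ball z \<rho>) = ennreal (cmod (f z)) * emeasure lborel (ball 0 \<rho> :: complex set)"
    by (cases "\<rho> \<ge> 0") (simp_all add: emeasure_ball ball_empty)
  also have "\<dots> = (\<integral>\<^sup>+\<zeta>. ennreal (cmod (f z)) * indicator (ball 0 \<rho> :: complex set) \<zeta> \<partial>lborel)"
    by (subst nn_integral_cmult_indicator) auto
  also have "\<dots> \<le> (\<integral>\<^sup>+\<zeta>. (\<integral>\<^sup>+t. F (e t * \<zeta>) * indicator {0..1} t \<partial>lborel) \<partial>lborel)"
  proof (rule nn_integral_mono)
    fix \<zeta> :: complex
    show "ennreal (cmod (f z)) * indicator (ball 0 \<rho>) \<zeta> \<le> (\<integral>\<^sup>+t. F (e t * \<zeta>) * indicator {0..1} t \<partial>lborel)"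
    proof (cases "\<zeta> \<in> ball 0 \<rho>")
      case True
      then have "cball z (cmod \<zeta>) \<subseteq> ball z \<rho>"
        by (auto simp: dist_norm)
      then have "f holomorphic_on cball z (cmod \<zeta>)"
        using holf holomorphic_on_subset by blast
      from circle_mean_value_le[OF this] True show ?thesis
        by (simp add: F_def e_def norm_mult)
    qed simp
  qed
  also have "\<dots> = (\<integral>\<^sup>+t. (\<integral>\<^sup>+\<zeta>. F (e t * \<zeta>) * indicator {0..1} t \<partial>lborel) \<partial>lborel)"
    by (rule lborel_pair.Fubini') measurable
  also have "\<dots> = (\<integral>\<^sup>+(t :: real). (\<integral>\<^sup>+\<zeta>. F \<zeta> \<partial>lborel) * indicator {0..1} t \<partial>lborel)"
    by (simp add: nn_integral_multc nn_integral_lborel_complex_rotate ne)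
  also have "\<dots> = (\<integral>\<^sup>+\<zeta>. F \<zeta> \<partial>lborel)"
    by (simp add: nn_integral_cmult)
  finally show ?thesis
    unfolding shift .
qed

section \<open>The Besov integrand as a measurable function\<close>

lemma besov_spaceD:
  assumes "f \<in> besov_space p"
  shows "f holomorphic_on unit_disc" "\<And>z. z \<notin> unit_disc \<Longrightarrow> f z = 0"
    "(\<integral>\<^sup>+ z. ennreal (besov_integrand p f z) \<partial>disc_area) < \<infinity>"
  using assms unfolding besov_space_def disc_analytic_def by blast+

text \<open>The indicator is there because holomorphy controls \<open>deriv f\<close> only inside
  the disc.\<close>

lemma besov_integrand_measurable:
  assumes "f holomorphic_on unit_disc"
  shows "(\<lambda>z. ennreal (besov_integrand p f z) * indicator unit_disc z) \<in> borel_measurable borel"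
proof -
  have "deriv f holomorphic_on unit_disc"
    using assms by (intro holomorphic_deriv) auto
  then have "(\<lambda>z. indicator unit_disc z *\<^sub>R deriv f z) \<in> borel_measurable borel"
    by (intro borel_measurable_continuous_on_indicator holomorphic_on_imp_continuous_on) auto
  moreover define g where "g = (\<lambda>z. indicator unit_disc z *\<^sub>R deriv f z)"
  ultimately have [measurable]: "g \<in> borel_measurable borel"
    by simp
  have "(\<lambda>z. ennreal ((1 - (cmod z)\<^sup>2) powr (p - 2) * cmod (g z) powr p) * indicator unit_disc z)
      \<in> borel_measurable borel"
    by measurable
  also have "(\<lambda>z. ennreal ((1 - (cmod z)\<^sup>2) powr (p - 2) * cmod (g z) powr p) * indicator unit_disc z)
      = (\<lambda>z. ennreal (besov_integrand p f z) * indicator unit_disc z)"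
    by (auto simp: besov_integrand_def indicator_def g_def)
  finally show ?thesis .
qed

lemma nn_integral_besov_integrand:
  assumes "f holomorphic_on unit_disc"
  shows "(\<integral>\<^sup>+ z. ennreal (besov_integrand p f z) \<partial>disc_area)
    = ennreal (1 / pi) * (\<integral>\<^sup>+ z. ennreal (besov_integrand p f z) * indicator unit_disc z \<partial>lborel)"
proof -
  have "(\<integral>\<^sup>+ z. ennreal (besov_integrand p f z) \<partial>disc_area)
      = (\<integral>\<^sup>+ z. ennreal (besov_integrand p f z) * indicator unit_disc z \<partial>disc_area)"
    by (rule nn_integral_cong_AE) (use AE_disc_area in \<open>eventually_elim, simp\<close>)
  also have "\<dots> = ennreal (1 / pi) * (\<integral>\<^sup>+ z. ennreal (besov_integrand p f z) * indicator unit_disc z \<partial>lborel)"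
    by (subst nn_integral_disc_area[OF besov_integrand_measurable[OF assms]])
       (simp add: mult.assoc indicator_inter_arith[symmetric])
  finally show ?thesis .
qed

section \<open>Growth of Besov functions\<close>

text \<open>The area mean value inequality is applied to \<open>f'\<close> on the disc about
  \<open>z\<close> whose radius \<rho> is half the distance to the unit circle. There the weight is
  comparable to \<open>\<rho> powr (p - 2)\<close>, so the Besov integral bounds the mean.\<close>

lemma besov_deriv_le:
  assumes f: "f \<in> besov_space p" and p: "p > 1"
  shows "\<exists>C\<ge>0. \<forall>z\<in>unit_disc. cmod (deriv f z) \<le> C / (1 - cmod z)"
proof -
  note holf = besov_spaceD(1)[OF f]
  have holf': "deriv f holomorphic_on unit_disc"
    using holf by (intro holomorphic_deriv) auto
  define J where "J = (\<integral>\<^sup>+ z. ennreal (besov_integrand p f z) * indicator unit_disc z \<partial>lborel)"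
  have "J < \<infinity>"
    using besov_spaceD(3)[OF f] unfolding nn_integral_besov_integrand[OF holf] J_def
    by (auto simp: ennreal_mult_less_top)
  then obtain M where M: "J = ennreal M" "M \<ge> 0"
    by (cases J) auto
  \<comment> \<open>On the discs used below, \<open>1 - |\<zeta>|^2\<close> lies between \<rho> and
    \<open>6 * \<rho>\<close>. The weight is thus at least \<open>c * \<rho> powr (p - 2)\<close>:
    the lower bound is used for \<open>p \<ge> 2\<close>, the upper one for
    \<open>p < 2\<close>.\<close>
  define c where "c = min 1 (6 powr (p - 2) :: real)"
  have c: "c > 0" by (simp add: c_def)
  have "cmod (deriv f z) \<le> (2 * (1 + M / (c * pi))) / (1 - cmod z)" if z: "z \<in> unit_disc" for z
  proof -
    define \<rho> where "\<rho> = (1 - cmod z) / 2"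
    have \<rho>: "\<rho> > 0" using z by (simp add: \<rho>_def)
    have near: "1 - (cmod \<zeta>)\<^sup>2 \<ge> \<rho>" "1 - (cmod \<zeta>)\<^sup>2 \<le> 6 * \<rho>" "\<zeta> \<in> unit_disc" if "\<zeta> \<in> ball z \<rho>" for \<zeta>
    proof -
      have "cmod (\<zeta> - z) < \<rho>" using that by (simp add: dist_norm norm_minus_commute)
      with norm_triangle_sub[of \<zeta> z] norm_triangle_sub[of z \<zeta>]
      have b: "1 - cmod \<zeta> \<ge> \<rho>" "1 - cmod \<zeta> \<le> 3 * \<rho>"
        by (simp_all add: \<rho>_def norm_minus_commute)
      show "\<zeta> \<in> unit_disc" using b \<rho> by simp
      have e: "1 - (cmod \<zeta>)\<^sup>2 = (1 - cmod \<zeta>) * (1 + cmod \<zeta>)"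
        by (simp add: power2_eq_square algebra_simps)
      have l: "(1 - cmod \<zeta>) * 1 \<le> (1 - cmod \<zeta>) * (1 + cmod \<zeta>)"
        using b \<rho> by (intro mult_left_mono) auto
      show "1 - (cmod \<zeta>)\<^sup>2 \<ge> \<rho>" using order_trans[OF b(1) l[unfolded mult_1_right]] by (simp only: e)
      have u: "(1 - cmod \<zeta>) * (1 + cmod \<zeta>) \<le> (1 - cmod \<zeta>) * 2"
        using b \<rho> by (intro mult_left_mono) auto
      show "1 - (cmod \<zeta>)\<^sup>2 \<le> 6 * \<rho>" using order_trans[OF u, of "6 * \<rho>"] b(2) unfolding e by simp
    qed
    have pw: "c * \<rho> powr (p - 2) \<le> (1 - (cmod \<zeta>)\<^sup>2) powr (p - 2)" if "\<zeta> \<in> ball z \<rho>" for \<zeta>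
    proof (cases "p \<ge> 2")
      case True
      have "c * \<rho> powr (p - 2) \<le> 1 * \<rho> powr (p - 2)"
        by (intro mult_right_mono) (auto simp: c_def)
      also have "\<dots> \<le> (1 - (cmod \<zeta>)\<^sup>2) powr (p - 2)"
        using near[OF that] True \<rho> by (simp add: powr_mono2)
      finally show ?thesis .
    next
      case False
      have "c * \<rho> powr (p - 2) \<le> 6 powr (p - 2) * \<rho> powr (p - 2)"
        by (intro mult_right_mono) (auto simp: c_def)
      also have "\<dots> = (6 * \<rho>) powr (p - 2)"
        using \<rho> by (simp add: powr_mult)
      also have "\<dots> \<le> (1 - (cmod \<zeta>)\<^sup>2) powr (p - 2)"
        using near[OF that] False \<rho> by (intro powr_mono2') auto
      finally show ?thesis .
    qed
    \<comment> \<open>The elementary \<open>x \<le> 1 + x powr p\<close> takes the place of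
      Hoelder's inequality. The scaling \<open>x = \<rho> * |f'|\<close> is chosen so that both
      terms integrate to a multiple of \<open>\<rho>^2\<close>, the order of the area of the
      disc.\<close>
    have pt: "\<rho> * cmod (deriv f \<zeta>) \<le> 1 + \<rho>\<^sup>2 / c * besov_integrand p f \<zeta>" if "\<zeta> \<in> ball z \<rho>" for \<zeta>
    proof -
      define x where "x = \<rho> * cmod (deriv f \<zeta>)"
      have x0: "x \<ge> 0" using \<rho> by (simp add: x_def)
      have "x \<le> 1 + x powr p"
      proof (cases "x \<ge> 1")
        case True
        then have "x powr 1 \<le> x powr p" using p by (intro powr_mono) auto
        then show ?thesis using True by simp
      next
        case False
        then show ?thesis using powr_ge_zero[of x p] by linarith
      qed
      also have "x powr p = \<rho>\<^sup>2 * (\<rho> powr (p - 2) * cmod (deriv f \<zeta>) powr p)"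
        using \<rho> powr_add[of \<rho> 2 "p - 2"] by (simp add: x_def powr_mult)
      also have "\<dots> \<le> \<rho>\<^sup>2 * ((1 - (cmod \<zeta>)\<^sup>2) powr (p - 2) / c * cmod (deriv f \<zeta>) powr p)"
        using pw[OF that] c by (intro mult_left_mono mult_right_mono) (auto simp: field_simps)
      also have "\<dots> = \<rho>\<^sup>2 / c * besov_integrand p f \<zeta>"
        by (simp add: besov_integrand_def)
      finally show ?thesis by (simp add: x_def)
    qed
    have "(\<lambda>\<zeta>. of_real \<rho> * deriv f \<zeta>) holomorphic_on ball z \<rho>"
      using near(3) by (intro holomorphic_intros holomorphic_on_subset[OF holf'] subsetI)
    from area_mean_value_le[OF this]
    have "ennreal (\<rho> * cmod (deriv f z)) * ennreal (pi * \<rho>\<^sup>2)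
        \<le> (\<integral>\<^sup>+\<zeta>. ennreal (\<rho> * cmod (deriv f \<zeta>)) * indicator (ball z \<rho>) \<zeta> \<partial>lborel)"
      using \<rho> by (simp add: norm_mult emeasure_ball unit_ball_vol_2)
    also have "\<dots> \<le> (\<integral>\<^sup>+\<zeta>. indicator (ball z \<rho>) \<zeta> +
        ennreal (\<rho>\<^sup>2 / c) * (ennreal (besov_integrand p f \<zeta>) * indicator unit_disc \<zeta>) \<partial>lborel)"
    proof (rule nn_integral_mono)
      fix \<zeta>
      show "ennreal (\<rho> * cmod (deriv f \<zeta>)) * indicator (ball z \<rho>) \<zeta> \<le> indicator (ball z \<rho>) \<zeta> +
        ennreal (\<rho>\<^sup>2 / c) * (ennreal (besov_integrand p f \<zeta>) * indicator unit_disc \<zeta>)"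
      proof (cases "\<zeta> \<in> ball z \<rho>")
        case True
        have b: "besov_integrand p f \<zeta> \<ge> 0" by (simp add: besov_integrand_def)
        have "ennreal (\<rho> * cmod (deriv f \<zeta>)) \<le> ennreal (1 + \<rho>\<^sup>2 / c * besov_integrand p f \<zeta>)"
          by (rule ennreal_leI[OF pt[OF True]])
        also have "\<dots> = 1 + ennreal (\<rho>\<^sup>2 / c) * ennreal (besov_integrand p f \<zeta>)"
          using b c by (subst ennreal_plus) (simp_all add: ennreal_mult[symmetric])
        finally show ?thesis unfolding indicator_simps(1)[OF True] indicator_simps(1)[OF near(3)[OF True]]
          by (simp only: mult_1_right)
      qed simp
    qed
    also have "\<dots> = emeasure lborel (ball z \<rho>) + ennreal (\<rho>\<^sup>2 / c) * J"
      unfolding J_def using besov_integrand_measurable[OF holf, of p]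
      by (subst nn_integral_add) (auto simp: nn_integral_cmult intro!: borel_measurable_indicator)
    also have "\<dots> = ennreal (pi * \<rho>\<^sup>2 + \<rho>\<^sup>2 / c * M)"
      using \<rho> c M by (simp add: emeasure_ball unit_ball_vol_2 ennreal_mult[symmetric] ennreal_plus[symmetric] del: ennreal_plus)
    finally have "\<rho> * cmod (deriv f z) * (pi * \<rho>\<^sup>2) \<le> pi * \<rho>\<^sup>2 + \<rho>\<^sup>2 / c * M"
      using \<rho> c M by (simp add: ennreal_mult[symmetric] ennreal_le_iff del: ennreal_plus)
    also have "\<dots> = (1 + M / (c * pi)) * (pi * \<rho>\<^sup>2)"
      using c by (simp add: field_simps)
    finally have "\<rho> * cmod (deriv f z) \<le> 1 + M / (c * pi)"
      using \<rho> by (subst (asm) mult_le_cancel_right) simp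
    then have "cmod (deriv f z) \<le> (1 + M / (c * pi)) / \<rho>"
      using \<rho> by (simp add: pos_le_divide_eq mult.commute)
    then show ?thesis
      by (simp add: \<rho>_def mult.commute)
  qed
  then show ?thesis
    using M c by (intro exI[of _ "2 * (1 + M / (c * pi))"]) auto
qed

text \<open>Integrating the derivative bound along a radius would give logarithmic growth. A power
  with arbitrarily small exponent \<eta> suffices, since the Besov weight can absorb it.\<close>

lemma besov_growth:
  assumes f: "f \<in> besov_space p" and p: "p > 1" and \<eta>: "\<eta> > 0"
  shows "\<exists>K\<ge>0. \<forall>z\<in>unit_disc. cmod (f z) \<le> K * (1 - (cmod z)\<^sup>2) powr (- \<eta>)"
proof -
  note holf = besov_spaceD(1)[OF f]
  obtain C where C: "C \<ge> 0" "\<And>z. z \<in> unit_disc \<Longrightarrow> cmod (deriv f z) \<le> C / (1 - cmod z)"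
    using besov_deriv_le[OF f p] by auto
  define K where "K = cmod (f 0) + C / \<eta> * 2 powr \<eta>"
  have "cmod (f z) \<le> K * (1 - (cmod z)\<^sup>2) powr (- \<eta>)" if z: "z \<in> unit_disc" for z
  proof -
    define r where "r = cmod z"
    have r: "0 \<le> r" "r < 1" using z by (auto simp: r_def)
    have sr: "s * r < 1" if "s \<le> 1" for s
      using mult_right_mono[OF that r(1)] r by linarith
    have nz: "1 - s * r \<noteq> 0" if "s \<in> {0..1}" for s
      using sr[of s] that by auto
    have inD: "of_real s * z \<in> unit_disc" if "0 \<le> s" "s \<le> 1" for s
      using sr[OF that(2)] that by (simp add: norm_mult r_def)
    \<comment> \<open>The right side is the increment over \<open>[0, 1]\<close> of
      \<open>C / \<eta> * (1 - s * r) powr (-\<eta>)\<close>, whose derivative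
      \<open>C * r * (1 - s * r) powr (-\<eta> - 1)\<close> dominates
      \<open>C * r / (1 - s * r)\<close>, the bound for the speed along the radius.\<close>
    have "cmod (f (of_real 1 * z) - f (of_real 0 * z)) \<le> C / \<eta> * (1 - 1 * r) powr (-\<eta>) - C / \<eta> * (1 - 0 * r) powr (-\<eta>)"
    proof (rule differentiable_bound_general)
      show "continuous_on {0..1} (\<lambda>s. f (of_real s * z))"
        by (rule continuous_on_compose2[OF holomorphic_on_imp_continuous_on[OF holf]])
           (use inD in \<open>auto intro!: continuous_intros simp del: mem_ball_0\<close>)
      show "continuous_on {0..1} (\<lambda>s. C / \<eta> * (1 - s * r) powr (-\<eta>))"
        by (intro continuous_intros ballI nz)
      fix s :: real assume s: "0 < s" "s < 1"
      have "(f has_field_derivative deriv f (of_real s * z)) (at (of_real s * z))"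
        using holf inD[of s] s by (intro holomorphic_derivI) auto
      then show "((\<lambda>s. f (of_real s * z)) has_vector_derivative (z * deriv f (of_real s * z))) (at s)"
        by (intro field_vector_diff_chain_at[of "\<lambda>s. of_real s * z" z, unfolded o_def])
           (auto intro!: derivative_eq_intros)
      show "((\<lambda>s. C / \<eta> * (1 - s * r) powr (-\<eta>)) has_vector_derivative
          (C * r * (1 - s * r) powr (-\<eta> - 1))) (at s)"
        unfolding has_real_derivative_iff_has_vector_derivative[symmetric]
        using sr[of s] s \<eta> by (auto intro!: derivative_eq_intros simp: field_simps powr_diff)
      have pos: "0 < 1 - s * r" using sr[of s] s by simp
      have pm: "(1 - s * r) powr (-1) \<le> (1 - s * r) powr (-\<eta> - 1)"
        using pos \<eta> s r by (intro powr_mono') auto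
      have "cmod (z * deriv f (of_real s * z)) \<le> r * (C / (1 - s * r))"
        unfolding norm_mult r_def[symmetric] using C(2)[OF inD[of s]] s r
        by (intro mult_left_mono) (auto simp: norm_mult r_def)
      also have "r * (C / (1 - s * r)) = r * (C * (1 - s * r) powr (-1))"
        using pos by (simp add: powr_minus_divide)
      also have "\<dots> \<le> r * (C * (1 - s * r) powr (-\<eta> - 1))"
        using C(1) r by (intro mult_left_mono pm)
      finally show "cmod (z * deriv f (of_real s * z)) \<le> C * r * (1 - s * r) powr (-\<eta> - 1)"
        by (simp only: mult.commute[of C r] mult.assoc)
    qed simp
    then have "cmod (f z - f 0) \<le> C / \<eta> * (1 - r) powr (-\<eta>) - C / \<eta>"
      by simp
    then have 1: "cmod (f z) \<le> cmod (f 0) + C / \<eta> * (1 - r) powr (-\<eta>)"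
      using norm_triangle_sub[of "f z" "f 0"] C \<eta> divide_nonneg_pos[of C \<eta>] by linarith
    have a: "0 < 1 - r\<^sup>2" "1 - r\<^sup>2 \<le> 1"
      using r abs_square_less_1[of r] by auto
    have a2: "(1 - r\<^sup>2) / 2 \<le> 1 - r"
      using zero_le_power2[of "1 - r"] by (simp add: power2_eq_square field_simps)
    have "(1 - r) powr (-\<eta>) \<le> ((1 - r\<^sup>2) / 2) powr (-\<eta>)"
      using a(1) \<eta> by (intro powr_mono2' a2) simp_all
    also have "\<dots> = (1 - r\<^sup>2) powr (-\<eta>) / 2 powr (-\<eta>)"
      by (rule powr_divide)
    also have "\<dots> = 2 powr \<eta> * (1 - r\<^sup>2) powr (-\<eta>)"
      unfolding powr_minus[of 2] by (simp only: divide_inverse inverse_inverse_eq mult.commute)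
    finally have 2: "C / \<eta> * (1 - r) powr (-\<eta>) \<le> C / \<eta> * (2 powr \<eta> * (1 - r\<^sup>2) powr (-\<eta>))"
      using C \<eta> by (intro mult_left_mono) auto
    have "1 \<le> (1 - r\<^sup>2) powr (-\<eta>)"
      using powr_mono2'[of "-\<eta>" "1 - r\<^sup>2" 1] a \<eta> by simp
    then have "cmod (f 0) \<le> cmod (f 0) * (1 - r\<^sup>2) powr (-\<eta>)"
      using mult_left_mono[of 1 "(1 - r\<^sup>2) powr (-\<eta>)" "cmod (f 0)"] by simp
    with 1 2 show ?thesis
      unfolding K_def r_def by (simp add: algebra_simps)
  qed
  moreover have "K \<ge> 0" using C \<eta> by (simp add: K_def)
  ultimately show ?thesis by blast
qed

section \<open>The Besov norm of the logarithmic test functions\<close>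

text \<open>Splitting at \<open>t = m\<close>: below, \<open>m powr (-p) * t powr (p - 2)\<close>
  has integral \<open>1 / ((p - 1) * m)\<close>; above, \<open>t powr (-2)\<close> has integral
  \<open>1 / m\<close>. This is the integral along one horizontal line in the estimate of the test
  functions.\<close>

lemma nn_integral_kernel_le:
  fixes m p :: real
  assumes m: "m > 0" and p: "p > 1"
  shows "(\<integral>\<^sup>+t. ennreal (t powr (p - 2) * max m t powr (-p)) * indicator {0<..} t \<partial>lborel)
    \<le> ennreal ((1 / (p - 1) + 1) / m)"
proof -
  define g where "g = (\<lambda>t::real. if m \<le> t then t powr (-2) else 0)"
  have [measurable]: "g \<in> borel_measurable borel"
    unfolding g_def by measurable
  have i1: "(\<integral>\<^sup>+t. ennreal (t powr (p - 2)) * indicator {0..m} t \<partial>lborel) = ennreal (m powr (p - 1) / (p - 1))"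
    using has_integral_powr_from_0[of "p - 2" m] m p
    by (subst nn_integral_has_integral_lebesgue') auto
  have i2: "(\<integral>\<^sup>+t. ennreal (g t) * indicator {m..} t \<partial>lborel) = ennreal (0 - (- (1 / m)))"
  proof (rule nn_integral_FTC_atLeast)
    fix t assume t: "m \<le> t"
    then have "((\<lambda>t. - (1 / t)) has_real_derivative 1 / t\<^sup>2) (at t)"
      using m by (auto intro!: derivative_eq_intros simp: power2_eq_square)
    also have "1 / t\<^sup>2 = g t"
      using t m by (simp add: g_def powr_minus_divide)
    finally show "((\<lambda>t. - (1 / t)) has_real_derivative g t) (at t)" .
    show "0 \<le> g t" by (simp add: g_def)
  next
    show "((\<lambda>t::real. - (1 / t)) \<longlongrightarrow> 0) at_top"
      by real_asymp
  qed measurable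
  have "(\<integral>\<^sup>+t. ennreal (t powr (p - 2) * max m t powr (-p)) * indicator {0<..} t \<partial>lborel)
      \<le> (\<integral>\<^sup>+t. ennreal (m powr (-p)) * (ennreal (t powr (p - 2)) * indicator {0..m} t) + ennreal (g t) * indicator {m..} t \<partial>lborel)"
  proof (rule nn_integral_mono)
    fix t :: real
    consider "t \<le> 0" | "0 < t" "t \<le> m" | "m < t" by linarith
    then show "ennreal (t powr (p - 2) * max m t powr (-p)) * indicator {0<..} t \<le>
        ennreal (m powr (-p)) * (ennreal (t powr (p - 2)) * indicator {0..m} t) + ennreal (g t) * indicator {m..} t"
    proof cases
      case 2
      then have "ennreal (t powr (p - 2) * max m t powr (-p)) * indicator {0<..} t
          = ennreal (m powr (-p)) * (ennreal (t powr (p - 2)) * indicator {0..m} t)"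
        using m by (simp add: ennreal_mult mult.commute)
      then show ?thesis by simp
    next
      case 3
      have "t powr (p - 2) * t powr (-p) = t powr (-2)"
        by (simp add: powr_add[symmetric])
      then have "ennreal (t powr (p - 2) * max m t powr (-p)) * indicator {0<..} t = ennreal (g t) * indicator {m..} t"
        using 3 m by (simp add: g_def)
      then show ?thesis by simp
    qed simp
  qed
  also have "\<dots> = ennreal (m powr (-p)) * ennreal (m powr (p - 1) / (p - 1)) + ennreal (1 / m)"
    by (subst nn_integral_add) (simp_all add: nn_integral_cmult i1 i2[simplified])
  also have "\<dots> = ennreal (m powr (-p) * (m powr (p - 1) / (p - 1)) + 1 / m)"
    using m p by (subst ennreal_plus) (simp_all add: ennreal_mult[symmetric])
  also have "m powr (-p) * (m powr (p - 1) / (p - 1)) = m powr (-1) / (p - 1)"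
    by (simp add: powr_add[symmetric])
  also have "m powr (-1) / (p - 1) + 1 / m = (1 / (p - 1) + 1) / m"
    using m by (simp add: powr_minus_divide add_divide_distrib mult.commute)
  finally show ?thesis .
qed

text \<open>By symmetry the integral is twice \<open>ln ((1/2 + e) / e)\<close>, and
  \<open>1/2 + e \<le> 1\<close>. The logarithm in the norm of the test functions comes from
  here.\<close>

lemma nn_integral_inverse_abs_le:
  fixes e :: real
  assumes e: "0 < e" "e \<le> 1 / 2"
  shows "(\<integral>\<^sup>+y. ennreal (1 / (\<bar>y\<bar> + e)) * indicator {-1/2..1/2} y \<partial>lborel) \<le> ennreal (2 * ln (1 / e))"
proof -
  define h where "h = (\<lambda>y. ennreal (1 / (\<bar>y\<bar> + e)) * indicator {0..1/2} y)"
  have [measurable]: "h \<in> borel_measurable borel"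
    unfolding h_def by measurable
  have "(\<integral>\<^sup>+y. h y \<partial>lborel) = (\<integral>\<^sup>+y. ennreal (1 / (\<bar>y\<bar> + e)) * indicator {0..1/2} y \<partial>lborel)"
    by (simp add: h_def)
  also have "\<dots> = ennreal (ln (1 / 2 + e) - ln (0 + e))"
  proof (rule nn_integral_FTC_Icc)
    fix y :: real assume "y \<in> {0..1 / 2}"
    then show "((\<lambda>y. ln (y + e)) has_real_derivative 1 / (\<bar>y\<bar> + e)) (at y)"
      using e by (auto intro!: derivative_eq_intros)
  qed (use e in auto)
  also have "\<dots> \<le> ennreal (ln (1 / e))"
    using e by (intro ennreal_leI) (simp add: ln_div)
  finally have h: "(\<integral>\<^sup>+y. h y \<partial>lborel) \<le> ennreal (ln (1 / e))" .
  have "(\<integral>\<^sup>+y. ennreal (1 / (\<bar>y\<bar> + e)) * indicator {-1/2..1/2} y \<partial>lborel)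
      \<le> (\<integral>\<^sup>+y. h y + h (- y) \<partial>lborel)"
    by (intro nn_integral_mono) (auto simp: h_def indicator_def)
  also have "\<dots> = (\<integral>\<^sup>+y. h y \<partial>lborel) + (\<integral>\<^sup>+y. h y \<partial>lborel)"
    using nn_integral_real_affine[of h "-1" 0] by (subst nn_integral_add) simp_all
  also have "\<dots> \<le> ennreal (ln (1 / e)) + ennreal (ln (1 / e))"
    by (intro add_mono h)
  also have "\<dots> = ennreal (2 * ln (1 / e))"
    using e by (simp add: ennreal_plus[symmetric] ln_div del: ennreal_plus)
  finally show ?thesis .
qed

text \<open>
  The angular decay is captured in Cartesian coordinates: at height \<open>y\<close>, with \<open>b = sqrt (1 - y\<^sup>2)\<close>
  and \<open>t = b - x\<close> the horizontal distance to the circle, \<open>1 - |z|\<^sup>2 = t (b + x)\<close> is comparable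
  to \<open>t\<close>, while \<open>|1 + e - z| \<ge> max |y| e t\<close>.
\<close>
lemma nn_integral_log_test_le:
  assumes p: "p > 1"
  shows "\<exists>A\<ge>0. \<exists>B\<ge>0. \<forall>e. 0 < e \<and> e \<le> 1 / 2 \<longrightarrow>
    (\<integral>\<^sup>+z. ennreal ((1 - (cmod z)\<^sup>2) powr (p - 2) * cmod (1 + of_real e - z) powr (-p)) \<partial>disc_area)
      \<le> ennreal (A + B * ln (1 / e))"
proof -
  \<comment> \<open>Bounds \<open>(b + x) powr (p - 2)\<close> for \<open>b + x\<close> in
    \<open>[1/2, 2]\<close>, whatever the sign of \<open>p - 2\<close>.\<close>
  define C where "C = 2 powr \<bar>p - 2\<bar>"
  define c2 where "c2 = 1 / (p - 1) + 1"
  have C: "C > 0" and c2: "c2 > 0" using p by (auto simp: C_def c2_def add_pos_pos)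
  define W where "W = (\<lambda>z. (1 - (cmod z)\<^sup>2) powr (p - 2))"
  define k where "k = (\<lambda>m t. ennreal (t powr (p - 2) * max m t powr (-p)) * indicator {0<..} t)"
  have bound: "(\<integral>\<^sup>+z. ennreal (W z * cmod (1 + of_real e - z) powr (-p)) \<partial>disc_area)
      \<le> ennreal (2 powr p / (p - 1) + 1 / pi * (C * (4 * c2)) * ln (1 / e))"
    if e: "0 < e" "e \<le> 1 / 2" for e
  proof -
    \<comment> \<open>The mean of the two lower bounds \<open>|y|\<close> and \<open>e\<close> for
      \<open>|1 + e - z|\<close> is again a lower bound, and is easier to integrate than their
      maximum.\<close>
    define m where "m = (\<lambda>y. (\<bar>y\<bar> + e) / 2)"
    define b where "b = (\<lambda>y::real. sqrt (1 - y\<^sup>2))"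
    have [measurable]: "m \<in> borel_measurable borel" "b \<in> borel_measurable borel"
      by (simp_all add: m_def b_def)
    have m0: "m y > 0" for y using e by (simp add: m_def add_nonneg_pos)
    define G where "G = (\<lambda>z. k (m (Im z)) (b (Im z) - Re z) * indicator {-1/2..1/2} (Im z))"
    have [measurable]: "G \<in> borel_measurable borel"
      unfolding G_def k_def by measurable
    have [measurable]: "(\<lambda>t. k c t) \<in> borel_measurable borel" for c
      unfolding k_def by measurable
    \<comment> \<open>If \<open>Re z < 0\<close> or \<open>|Im z| > 1/2\<close>, then
      \<open>|1 + e - z| \<ge> 1/2\<close> and the weight alone is a majorant up to the factor
      \<open>2 powr p\<close>. The rest of the disc, the part near 1, is handled by
      \<open>G\<close>.\<close>
    have pt: "ennreal (W z * cmod (1 + of_real e - z) powr (-p)) * indicator unit_disc z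
        \<le> ennreal (2 powr p) * (ennreal (W z) * indicator unit_disc z) + ennreal C * G z" for z
    proof (cases "z \<in> unit_disc")
      case z: True
      define x y where "x = Re z" and "y = Im z"
      have n: "(cmod z)\<^sup>2 = x\<^sup>2 + y\<^sup>2" by (simp add: cmod_def x_def y_def)
      have n1: "x\<^sup>2 + y\<^sup>2 < 1" using z n abs_square_less_1[of "cmod z"] by simp
      have u: "Re (1 + of_real e - z) = 1 + e - x" "Im (1 + of_real e - z) = - y"
        by (simp_all add: x_def y_def)
      have ux: "\<bar>1 + e - x\<bar> \<le> cmod (1 + of_real e - z)" and uy: "\<bar>y\<bar> \<le> cmod (1 + of_real e - z)"
        using abs_Re_le_cmod[of "1 + of_real e - z"] abs_Im_le_cmod[of "1 + of_real e - z"] unfolding u by simp_all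
      have W0: "W z \<ge> 0" by (simp add: W_def)
      show ?thesis
      proof (cases "x \<ge> 0 \<and> \<bar>y\<bar> \<le> 1 / 2")
        case False
        then have half: "cmod (1 + of_real e - z) \<ge> 1 / 2"
          using ux uy e by (cases "x \<ge> 0") auto
        have "cmod (1 + of_real e - z) powr (-p) \<le> (1 / 2) powr (-p)"
          using half p by (intro powr_mono2') auto
        also have "\<dots> = 2 powr p"
          by (simp add: powr_divide powr_minus_divide)
        finally have "W z * cmod (1 + of_real e - z) powr (-p) \<le> 2 powr p * W z"
          using W0 by (subst mult.commute) (rule mult_right_mono)
        then have "ennreal (W z * cmod (1 + of_real e - z) powr (-p)) \<le> ennreal (2 powr p * W z)"
          by (rule ennreal_leI)
        also have "\<dots> = ennreal (2 powr p) * ennreal (W z)"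
          using W0 by (simp add: ennreal_mult)
        finally show ?thesis
          using z by (simp add: add_increasing2)
      next
        case True
        have y2: "y\<^sup>2 \<le> 1 / 4"
          using True abs_le_square_iff[of y "1 / 2"] by (simp add: power2_eq_square)
        have yi: "y \<in> {-1/2..1/2}"
          using True by (auto simp: abs_le_iff)
        define t where "t = b y - x"
        have b2: "(b y)\<^sup>2 = 1 - y\<^sup>2"
          using y2 by (simp add: b_def)
        have bb: "1 / 2 \<le> b y" "b y \<le> 1"
          using y2 real_le_rsqrt[of "1 / 2" "1 - y\<^sup>2"] by (simp_all add: b_def power2_eq_square[of "1 / 2 :: real"])
        have t0: "t > 0"
          using power2_less_imp_less[of x "b y"] n1 b2 bb by (simp add: t_def)
        have s: "1 / 2 \<le> b y + x" "b y + x \<le> 2"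
          using True bb t0 unfolding t_def by auto
        have "W z = (t * (b y + x)) powr (p - 2)"
        proof -
          have "t * (b y + x) = (b y)\<^sup>2 - x\<^sup>2"
            by (simp add: t_def power2_eq_square algebra_simps)
          also have "\<dots> = 1 - (cmod z)\<^sup>2"
            by (simp add: n b2)
          finally show ?thesis by (simp add: W_def)
        qed
        also have "\<dots> = t powr (p - 2) * (b y + x) powr (p - 2)"
          using t0 s by (simp add: powr_mult)
        also have "(b y + x) powr (p - 2) \<le> C"
        proof (cases "p \<ge> 2")
          case True
          then show ?thesis using s powr_mono2[of "p - 2" "b y + x" 2] by (simp add: C_def)
        next
          case False
          then have "(b y + x) powr (p - 2) \<le> (1 / 2) powr (p - 2)"
            using s by (intro powr_mono2') auto
          also have "\<dots> = C"
            using False by (simp add: C_def powr_divide powr_minus_divide[of 2, symmetric])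
          finally show ?thesis .
        qed
        finally have Wle: "W z \<le> t powr (p - 2) * C"
          by (simp add: mult_left_mono)
        have "1 + e - x \<le> cmod (1 + of_real e - z)"
          using ux by simp
        then have "e \<le> cmod (1 + of_real e - z)" and "t \<le> cmod (1 + of_real e - z)"
          using bb t0 e unfolding t_def by auto
        moreover from this(1) have "m y \<le> cmod (1 + of_real e - z)"
          using uy by (simp add: m_def)
        ultimately have "cmod (1 + of_real e - z) powr (-p) \<le> max (m y) t powr (-p)"
          using t0 p by (intro powr_mono2') auto
        then have "W z * cmod (1 + of_real e - z) powr (-p) \<le> (t powr (p - 2) * C) * max (m y) t powr (-p)"
          using C by (intro mult_mono Wle) auto
        then have "ennreal (W z * cmod (1 + of_real e - z) powr (-p))
            \<le> ennreal (C * (t powr (p - 2) * max (m y) t powr (-p)))"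
          by (intro ennreal_leI) (simp add: mult_ac)
        also have "\<dots> = ennreal C * G z"
          using yi t0 C by (subst ennreal_mult) (auto simp: G_def k_def t_def x_def y_def)
        finally show ?thesis
          using z by (simp add: add_increasing)
      qed
    qed simp
    \<comment> \<open>On the line of height \<open>y\<close> the substitution
      \<open>t = b y - x\<close> turns the inner integral into that of the kernel, at most
      \<open>c2 / m y\<close>; this is then integrated over \<open>|y| \<le> 1/2\<close>.\<close>
    have GI: "(\<integral>\<^sup>+z. G z \<partial>lborel) \<le> ennreal (4 * c2 * ln (1 / e))"
    proof -
      have "(\<integral>\<^sup>+z. G z \<partial>lborel) = (\<integral>\<^sup>+y. (\<integral>\<^sup>+x. k (m y) (b y - x) \<partial>lborel) * indicator {-1/2..1/2} y \<partial>lborel)"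
        by (subst nn_integral_lborel_complex(1), measurable) (simp add: G_def nn_integral_multc)
      also have "\<dots> = (\<integral>\<^sup>+y. (\<integral>\<^sup>+t. k (m y) t \<partial>lborel) * indicator {-1/2..1/2} y \<partial>lborel)"
        using nn_integral_real_affine[of "k c" "-1" d for c d] by simp
      also have "\<dots> \<le> (\<integral>\<^sup>+y. ennreal (2 * c2) * (ennreal (1 / (\<bar>y\<bar> + e)) * indicator {-1/2..1/2} y) \<partial>lborel)"
      proof (rule nn_integral_mono)
        fix y :: real
        have "(\<integral>\<^sup>+t. k (m y) t \<partial>lborel) \<le> ennreal (c2 / m y)"
          using nn_integral_kernel_le[OF m0 p] by (simp add: k_def c2_def)
        also have "c2 / m y = 2 * c2 * (1 / (\<bar>y\<bar> + e))"
          by (simp add: m_def)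
        also have "ennreal \<dots> = ennreal (2 * c2) * ennreal (1 / (\<bar>y\<bar> + e))"
          using c2 e by (intro ennreal_mult) auto
        finally show "(\<integral>\<^sup>+t. k (m y) t \<partial>lborel) * indicator {-1/2..1/2} y
            \<le> ennreal (2 * c2) * (ennreal (1 / (\<bar>y\<bar> + e)) * indicator {-1/2..1/2} y)"
          unfolding mult.assoc[symmetric] by (rule mult_right_mono) simp
      qed
      also have "\<dots> = ennreal (2 * c2) * (\<integral>\<^sup>+y. ennreal (1 / (\<bar>y\<bar> + e)) * indicator {-1/2..1/2} y \<partial>lborel)"
        by (rule nn_integral_cmult) measurable
      also have "\<dots> \<le> ennreal (2 * c2) * ennreal (2 * ln (1 / e))"
        by (intro mult_left_mono nn_integral_inverse_abs_le e) simp
      also have "\<dots> = ennreal (4 * c2 * ln (1 / e))"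
        using c2 e by (simp add: ennreal_mult[symmetric] ln_div mult.assoc)
      finally show ?thesis .
    qed
    have [measurable]: "W \<in> borel_measurable borel"
      by (simp add: W_def)
    have WI: "ennreal (1 / pi) * (\<integral>\<^sup>+z. ennreal (W z) * indicator unit_disc z \<partial>lborel) = ennreal (1 / (p - 1))"
      using nn_integral_disc_area_powr[of "p - 2"] p
      by (simp add: nn_integral_disc_area[symmetric] W_def)
    have "(\<integral>\<^sup>+z. ennreal (W z * cmod (1 + of_real e - z) powr (-p)) \<partial>disc_area)
        = ennreal (1 / pi) * (\<integral>\<^sup>+z. ennreal (W z * cmod (1 + of_real e - z) powr (-p)) * indicator unit_disc z \<partial>lborel)"
      by (rule nn_integral_disc_area) measurable
    also have "\<dots> \<le> ennreal (1 / pi) *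
        (\<integral>\<^sup>+z. ennreal (2 powr p) * (ennreal (W z) * indicator unit_disc z) + ennreal C * G z \<partial>lborel)"
      by (intro mult_left_mono nn_integral_mono pt) simp
    also have "\<dots> = ennreal (1 / pi) * (ennreal (2 powr p) * (\<integral>\<^sup>+z. ennreal (W z) * indicator unit_disc z \<partial>lborel) +
        ennreal C * (\<integral>\<^sup>+z. G z \<partial>lborel))"
      by (subst nn_integral_add) (simp_all add: nn_integral_cmult)
    also have "\<dots> = ennreal (2 powr p) * ennreal (1 / (p - 1)) + ennreal (1 / pi) * (ennreal C * (\<integral>\<^sup>+z. G z \<partial>lborel))"
      unfolding WI[symmetric]
      by (simp add: distrib_left mult.left_commute)
    also have "\<dots> \<le> ennreal (2 powr p) * ennreal (1 / (p - 1)) + ennreal (1 / pi) * (ennreal C * ennreal (4 * c2 * ln (1 / e)))"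
      by (intro add_mono mult_left_mono GI) auto
    also have "\<dots> = ennreal (2 powr p / (p - 1) + 1 / pi * (C * (4 * c2)) * ln (1 / e))"
    proof -
      have "ennreal (2 powr p) * ennreal (1 / (p - 1)) + ennreal (1 / pi) * (ennreal C * ennreal (4 * c2 * L))
          = ennreal (2 powr p / (p - 1) + 1 / pi * (C * (4 * c2)) * L)" if "L \<ge> 0" for L
        using p C c2 that by (subst ennreal_plus) (auto simp: ennreal_mult[symmetric] mult.assoc)
      moreover have "ln (1 / e) \<ge> 0"
        using e by (intro ln_ge_zero) (simp add: field_simps)
      ultimately show ?thesis by blast
    qed
    finally show ?thesis .
  qed
  show ?thesis
  proof (intro exI conjI allI impI)
    show "0 \<le> 2 powr p / (p - 1)" "0 \<le> 1 / pi * (C * (4 * c2))"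
      using p C c2 by auto
  qed (use bound in \<open>simp add: W_def\<close>)
qed

section \<open>Closure properties of the Besov space\<close>

text \<open>Produces the representative demanded by \<open>disc_analytic\<close>. In particular
  \<open>disc_restrict (\<lambda>_. 1)\<close> stands for the constant one, which as a total
  function does not vanish off the disc.\<close>

definition disc_restrict :: "(complex \<Rightarrow> complex) \<Rightarrow> complex \<Rightarrow> complex" where
  "disc_restrict f z = (if z \<in> unit_disc then f z else 0)"

lemma disc_restrict_in [simp]: "z \<in> unit_disc \<Longrightarrow> disc_restrict f z = f z"
  by (simp add: disc_restrict_def)

lemma disc_restrict_analytic:
  assumes "f holomorphic_on unit_disc"
  shows "disc_restrict f \<in> disc_analytic"
  using holomorphic_transform[OF assms, of "disc_restrict f"]
  by (simp add: disc_analytic_def disc_restrict_def)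

lemma deriv_eq_on_unit_disc:
  assumes "\<And>z. z \<in> unit_disc \<Longrightarrow> f z = g z" "z \<in> unit_disc"
  shows "deriv f z = deriv g z"
proof (rule deriv_cong_ev)
  show "\<forall>\<^sub>F x in nhds z. f x = g x"
    using assms eventually_nhds by (auto simp: eventually_nhds intro!: exI[of _ unit_disc])
qed simp

lemma besov_space_dominated:
  assumes "f \<in> disc_analytic"
    and "\<And>z. z \<in> unit_disc \<Longrightarrow> ennreal (besov_integrand p f z) \<le> F z"
    and "(\<integral>\<^sup>+z. F z \<partial>disc_area) < \<infinity>"
  shows "f \<in> besov_space p"
proof -
  have "AE z in disc_area. ennreal (besov_integrand p f z) \<le> F z"
    using AE_disc_area by eventually_elim (rule assms(2))
  then have "(\<integral>\<^sup>+z. ennreal (besov_integrand p f z) \<partial>disc_area) \<le> (\<integral>\<^sup>+z. F z \<partial>disc_area)"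
    by (rule nn_integral_mono_AE)
  with assms(1,3) show ?thesis
    unfolding besov_space_def by (simp add: le_less_trans)
qed

text \<open>Constants do not affect the derivative. The constant is written as a multiple of the
  representative of 1 so that linearity of an operator applies to the sum.\<close>

lemma besov_space_add_const:
  assumes f: "f \<in> besov_space p"
  shows "(\<lambda>z. f z + c * disc_restrict (\<lambda>_. 1) z) \<in> besov_space p"
proof (rule besov_space_dominated[OF _ _ besov_spaceD(3)[OF f]])
  note holf = besov_spaceD(1)[OF f]
  have "(\<lambda>z. f z + c) holomorphic_on unit_disc"
    using holf by (intro holomorphic_intros)
  moreover have "(\<lambda>z. f z + c * disc_restrict (\<lambda>_. 1) z) = disc_restrict (\<lambda>z. f z + c)"
    using besov_spaceD(2)[OF f] by (auto simp: disc_restrict_def)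
  ultimately show "(\<lambda>z. f z + c * disc_restrict (\<lambda>_. 1) z) \<in> disc_analytic"
    using disc_restrict_analytic by simp
  fix z :: complex assume z: "z \<in> unit_disc"
  have "deriv (\<lambda>z. f z + c * disc_restrict (\<lambda>_. 1) z) z = deriv (\<lambda>z. f z + c) z"
    by (rule deriv_eq_on_unit_disc[OF _ z]) simp
  also have "\<dots> = deriv f z"
    using holomorphic_on_imp_differentiable_at[OF holf _ z] by (subst deriv_add) auto
  finally show "ennreal (besov_integrand p (\<lambda>z. f z + c * disc_restrict (\<lambda>_. 1) z) z) \<le> ennreal (besov_integrand p f z)"
    by (simp add: besov_integrand_def)
qed

text \<open>The derivative is bounded on the closed disc and the weight is integrable. This supplies
  the constants, the identity, \<open>1 / (id - a)\<close> with \<open>|a| > 1\<close>, and the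
  logarithmic test functions.\<close>

lemma disc_restrict_in_besov_space:
  assumes p: "p > 1" and R: "R > 1" and holf: "f holomorphic_on ball 0 R"
  shows "disc_restrict f \<in> besov_space p"
proof -
  have holD: "f holomorphic_on unit_disc"
    using R by (intro holomorphic_on_subset[OF holf]) auto
  have "compact (deriv f ` cball 0 1)"
    using holomorphic_deriv[OF holf] R
    by (intro compact_continuous_image holomorphic_on_imp_continuous_on)
       (auto elim: holomorphic_on_subset)
  from compact_imp_bounded[OF this] obtain B where B: "B > 0" "\<And>z. z \<in> cball 0 1 \<Longrightarrow> cmod (deriv f z) \<le> B"
    unfolding bounded_pos by auto
  show ?thesis
  proof (rule besov_space_dominated)
    show "disc_restrict f \<in> disc_analytic"
      by (rule disc_restrict_analytic[OF holD])
  next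
    fix z :: complex assume z: "z \<in> unit_disc"
    have "cmod (deriv f z) powr p \<le> B powr p"
      using B(2)[of z] z p by (intro powr_mono2) auto
    then have "besov_integrand p (disc_restrict f) z \<le> B powr p * (1 - (cmod z)\<^sup>2) powr (p - 2)"
      using deriv_eq_on_unit_disc[of "disc_restrict f" f z] z
      by (simp add: besov_integrand_def mult.commute mult_right_mono)
    then show "ennreal (besov_integrand p (disc_restrict f) z)
        \<le> ennreal (B powr p) * ennreal ((1 - (cmod z)\<^sup>2) powr (p - 2))"
      by (simp add: ennreal_mult[symmetric] ennreal_leI)
  next
    have "(\<integral>\<^sup>+z. ennreal (B powr p) * ennreal ((1 - (cmod z)\<^sup>2) powr (p - 2)) \<partial>disc_area)
        = ennreal (B powr p) * ennreal (1 / (p - 1))"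
      using nn_integral_disc_area_powr[of "p - 2"] p by (subst nn_integral_cmult) auto
    then show "(\<integral>\<^sup>+z. ennreal (B powr p) * ennreal ((1 - (cmod z)\<^sup>2) powr (p - 2)) \<partial>disc_area) < \<infinity>"
      by (simp add: ennreal_mult_less_top)
  qed
qed

lemma powr_add_le:
  fixes a b p :: real
  assumes "a \<ge> 0" "b \<ge> 0" "p \<ge> 0"
  shows "(a + b) powr p \<le> 2 powr p * (a powr p + b powr p)"
proof -
  have "(a + b) powr p \<le> (2 * max a b) powr p"
    using assms by (intro powr_mono2) auto
  also have "\<dots> = 2 powr p * max a b powr p"
    using assms by (simp add: powr_mult)
  also have "max a b powr p \<le> a powr p + b powr p"
    by (simp add: max_def)
  finally show ?thesis by (simp add: mult_left_mono)
qed

text \<open>Away from \<open>w\<close> one has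
  \<open>g' = f' / (z - w) - (f - f w) / (z - w)^2\<close>. The first term is controlled by
  \<open>f'\<close>, the second by the growth of \<open>f\<close>; near \<open>w\<close> the
  derivative of \<open>g\<close> is bounded by compactness.\<close>

lemma besov_difference_quotient:
  assumes f: "f \<in> besov_space p" and p: "p > 1" and w: "w \<in> unit_disc"
  obtains g where "g \<in> besov_space p" "\<And>z. z \<in> unit_disc \<Longrightarrow> f z - f w = (z - w) * g z"
proof -
  note holf = besov_spaceD(1)[OF f]
  \<comment> \<open>Small enough that the weight times
    \<open>(1 - |z|^2) powr (- \<eta> * p)\<close> stays integrable: the total exponent is
    \<open>(p - 1) / 2 - 1 > -1\<close>.\<close>
  define \<eta> where "\<eta> = (p - 1) / (2 * p)"
  have \<eta>: "\<eta> > 0" "p - 2 - \<eta> * p = (p - 1) / 2 - 1"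
    using p by (auto simp: \<eta>_def field_simps)
  obtain K where K: "K \<ge> 0" "\<And>z. z \<in> unit_disc \<Longrightarrow> cmod (f z) \<le> K * (1 - (cmod z)\<^sup>2) powr (- \<eta>)"
    using besov_growth[OF f p \<eta>(1)] by auto
  define g where "g = (\<lambda>z. if z = w then deriv f w else (f z - f w) / (z - w))"
  have holg: "g holomorphic_on unit_disc"
    unfolding g_def by (rule pole_lemma_open[OF holf]) simp
  define R where "R = (1 + cmod w) / 2"
  define \<delta> where "\<delta> = (1 - cmod w) / 2"
  have R: "cmod w < R" "R < 1" "\<delta> > 0" "R - cmod w = \<delta>"
    using w by (auto simp: R_def \<delta>_def field_simps)
  have "compact (deriv g ` cball 0 R)"
    using holomorphic_deriv[OF holg] R
    by (intro compact_continuous_image holomorphic_on_imp_continuous_on)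
       (auto elim!: holomorphic_on_subset)
  from compact_imp_bounded[OF this] obtain B where B: "B > 0" "\<And>z. z \<in> cball 0 R \<Longrightarrow> cmod (deriv g z) \<le> B"
    unfolding bounded_pos by auto
  \<comment> \<open>One constant for both regions: \<open>B\<close> serves
    \<open>|z| \<le> R\<close>, the other summands serve \<open>|z| > R\<close>, where
    \<open>|z - w| \<ge> \<delta>\<close>. Constants are absorbed by
    \<open>(1 - |z|^2) powr (- \<eta>) \<ge> 1\<close>.\<close>
  define M where "M = B + 1 / \<delta> + (K + cmod (f w)) / \<delta>\<^sup>2"
  have M: "M > 0" "B \<le> M" "1 / \<delta> \<le> M" "(K + cmod (f w)) / \<delta>\<^sup>2 \<le> M"
    using B K R by (auto simp: M_def add_pos_nonneg)
  have dg: "cmod (deriv g z) \<le> M * (cmod (deriv f z) + (1 - (cmod z)\<^sup>2) powr (- \<eta>))" if z: "z \<in> unit_disc" for z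
  proof -
    define P where "P = (1 - (cmod z)\<^sup>2) powr (- \<eta>)"
    have "0 < 1 - (cmod z)\<^sup>2" using z abs_square_less_1[of "cmod z"] by simp
    then have P: "P \<ge> 1"
      unfolding P_def using powr_mono2'[of "-\<eta>" "1 - (cmod z)\<^sup>2" 1] \<eta> by simp
    show ?thesis
    proof (cases "cmod z \<le> R")
      case True
      then have "cmod (deriv g z) \<le> M * 1" using B(2)[of z] M by simp
      also have "\<dots> \<le> M * (cmod (deriv f z) + P)"
        using P M by (intro mult_left_mono) (auto intro: add_increasing)
      finally show ?thesis by (simp add: P_def)
    next
      case False
      then have zw: "z \<noteq> w" using R by auto
      have d: "\<delta> \<le> cmod (z - w)"
        using norm_triangle_ineq2[of z w] R False by linarith
      have "(g has_field_derivative (deriv f z * (z - w) - (f z - f w)) / (z - w)\<^sup>2) (at z)"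
      proof (rule has_field_derivative_transform_within_open[where S = "- {w}"])
        have "(f has_field_derivative deriv f z) (at z)"
          using holf z by (intro holomorphic_derivI) auto
        then show "((\<lambda>z. (f z - f w) / (z - w)) has_field_derivative (deriv f z * (z - w) - (f z - f w)) / (z - w)\<^sup>2) (at z)"
          using zw by (auto intro!: derivative_eq_intros simp: power2_eq_square)
      qed (use zw in \<open>auto simp: g_def\<close>)
      then have "deriv g z = deriv f z / (z - w) - (f z - f w) / (z - w)\<^sup>2"
        using zw by (simp add: DERIV_imp_deriv diff_divide_distrib power2_eq_square)
      then have "cmod (deriv g z) \<le> cmod (deriv f z) / cmod (z - w) + cmod (f z - f w) / (cmod (z - w))\<^sup>2"
        using norm_triangle_ineq4[of "deriv f z / (z - w)" "(f z - f w) / (z - w)\<^sup>2"]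
        by (simp add: norm_divide norm_power)
      also have "\<dots> \<le> cmod (deriv f z) / \<delta> + (K + cmod (f w)) * P / \<delta>\<^sup>2"
      proof (intro add_mono frac_le)
        have "cmod (f z - f w) \<le> K * P + cmod (f w)"
          using norm_triangle_ineq4[of "f z" "f w"] K(2)[OF z] by (simp add: P_def)
        also have "cmod (f w) \<le> cmod (f w) * P"
          using mult_left_mono[OF P, of "cmod (f w)"] by simp
        finally show "cmod (f z - f w) \<le> (K + cmod (f w)) * P"
          by (simp add: algebra_simps)
        show "\<delta>\<^sup>2 \<le> (cmod (z - w))\<^sup>2"
          using d R by (intro power_mono) auto
      qed (use d R K P in auto)
      also have "\<dots> = 1 / \<delta> * cmod (deriv f z) + (K + cmod (f w)) / \<delta>\<^sup>2 * P"
        by simp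
      also have "\<dots> \<le> M * cmod (deriv f z) + M * P"
        using P by (intro add_mono mult_right_mono M) auto
      finally show ?thesis by (simp add: P_def distrib_left)
    qed
  qed
  have "disc_restrict g \<in> besov_space p"
  proof (rule besov_space_dominated)
    show "disc_restrict g \<in> disc_analytic"
      by (rule disc_restrict_analytic[OF holg])
    let ?c = "M powr p * 2 powr p"
    let ?F = "\<lambda>z. ennreal (besov_integrand p f z) * indicator unit_disc z"
    let ?G = "\<lambda>z. ennreal ((1 - (cmod z)\<^sup>2) powr ((p - 1) / 2 - 1))"
    show "ennreal (besov_integrand p (disc_restrict g) z) \<le> ennreal ?c * (?F z + ?G z)"
      if z: "z \<in> unit_disc" for z
    proof -
      have s: "0 < 1 - (cmod z)\<^sup>2" using z abs_square_less_1[of "cmod z"] by simp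
      have "cmod (deriv g z) powr p \<le> (M * (cmod (deriv f z) + (1 - (cmod z)\<^sup>2) powr (- \<eta>))) powr p"
        using dg[OF z] p by (intro powr_mono2) auto
      also have "\<dots> = M powr p * (cmod (deriv f z) + (1 - (cmod z)\<^sup>2) powr (- \<eta>)) powr p"
        using M by (simp add: powr_mult)
      also have "\<dots> \<le> M powr p * (2 powr p * (cmod (deriv f z) powr p + ((1 - (cmod z)\<^sup>2) powr (- \<eta>)) powr p))"
        using p by (intro mult_left_mono powr_add_le) auto
      finally have "besov_integrand p g z \<le> (1 - (cmod z)\<^sup>2) powr (p - 2) *
          (?c * (cmod (deriv f z) powr p + (1 - (cmod z)\<^sup>2) powr (- \<eta> * p)))"
        unfolding besov_integrand_def by (intro mult_left_mono) (simp_all add: powr_powr mult.assoc)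
      also have "\<dots> = ?c * (besov_integrand p f z + (1 - (cmod z)\<^sup>2) powr (p - 2) * (1 - (cmod z)\<^sup>2) powr (- \<eta> * p))"
        by (simp add: besov_integrand_def algebra_simps)
      also have "(1 - (cmod z)\<^sup>2) powr (p - 2) * (1 - (cmod z)\<^sup>2) powr (- \<eta> * p) = (1 - (cmod z)\<^sup>2) powr ((p - 1) / 2 - 1)"
        unfolding powr_add[symmetric] \<eta>(2)[symmetric] by simp
      finally have le: "besov_integrand p g z \<le> ?c * (besov_integrand p f z + (1 - (cmod z)\<^sup>2) powr ((p - 1) / 2 - 1))" .
      have eq: "besov_integrand p (disc_restrict g) z = besov_integrand p g z"
        using deriv_eq_on_unit_disc[of "disc_restrict g" g z] z by (simp add: besov_integrand_def)
      have b: "besov_integrand p f z \<ge> 0" by (simp add: besov_integrand_def)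
      have "ennreal (besov_integrand p (disc_restrict g) z)
          \<le> ennreal (?c * (besov_integrand p f z + (1 - (cmod z)\<^sup>2) powr ((p - 1) / 2 - 1)))"
        unfolding eq by (rule ennreal_leI[OF le])
      also have "\<dots> = ennreal ?c * ennreal (besov_integrand p f z + (1 - (cmod z)\<^sup>2) powr ((p - 1) / 2 - 1))"
        using b by (intro ennreal_mult) auto
      also have "\<dots> = ennreal ?c * (?F z + ?G z)"
        using z b by (subst ennreal_plus) auto
      finally show ?thesis .
    qed
    have "(\<integral>\<^sup>+z. ?F z \<partial>disc_area) = (\<integral>\<^sup>+z. ennreal (besov_integrand p f z) \<partial>disc_area)"
      by (rule nn_integral_cong_AE) (use AE_disc_area in \<open>eventually_elim, simp\<close>)
    then have 1: "(\<integral>\<^sup>+z. ?F z \<partial>disc_area) < \<infinity>"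
      using besov_spaceD(3)[OF f] by simp
    have 2: "(\<integral>\<^sup>+z. ?G z \<partial>disc_area) < \<infinity>"
      using nn_integral_disc_area_powr[of "(p - 1) / 2 - 1"] p by simp
    have [measurable]: "?F \<in> borel_measurable borel"
      by (rule besov_integrand_measurable[OF holf])
    have "(\<integral>\<^sup>+z. ennreal ?c * (?F z + ?G z) \<partial>disc_area) = ennreal ?c * ((\<integral>\<^sup>+z. ?F z \<partial>disc_area) + (\<integral>\<^sup>+z. ?G z \<partial>disc_area))"
      by (subst nn_integral_cmult, measurable) (subst nn_integral_add, auto)
    also have "\<dots> < \<infinity>"
      using 1 2 by (simp add: ennreal_mult_less_top)
    finally show "(\<integral>\<^sup>+z. ennreal ?c * (?F z + ?G z) \<partial>disc_area) < \<infinity>" .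
  qed
  moreover have "f z - f w = (z - w) * disc_restrict g z" if "z \<in> unit_disc" for z
    using that by (simp add: g_def)
  ultimately show ?thesis by (rule that)
qed

section \<open>Multiplicative operators\<close>

text \<open>A power \<open>q < 1\<close> of an affine function grows more slowly than
  \<open>L\<close>. It will be used with \<open>q = 1 / p\<close> and \<open>L = ln (1 / e)\<close>,
  setting the norm of a test function against its value.\<close>

lemma affine_powr_less:
  fixes A B C q :: real
  assumes "A \<ge> 0" "B \<ge> 0" "0 < q" "q < 1"
  shows "\<exists>L\<ge>1. C * (1 + (A + B * L) powr q) < L"
proof -
  \<comment> \<open>Enlarging \<open>A\<close> and \<open>B\<close> by one makes the coefficients
    positive, so the base tends to infinity even when \<open>B = 0\<close>.\<close>
  have "((\<lambda>L. \<bar>C\<bar> * (1 + ((A + 1) + (B + 1) * L) powr q) / L) \<longlongrightarrow> 0) at_top"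
    using assms by real_asymp
  then have "eventually (\<lambda>L. \<bar>C\<bar> * (1 + ((A + 1) + (B + 1) * L) powr q) / L < 1) at_top"
    by (rule order_tendstoD) simp
  then have "eventually (\<lambda>L. L \<ge> 1 \<and> \<bar>C\<bar> * (1 + ((A + 1) + (B + 1) * L) powr q) / L < 1) at_top"
    using eventually_ge_at_top[of 1] by eventually_elim simp
  then obtain L where L: "L \<ge> 1" "\<bar>C\<bar> * (1 + ((A + 1) + (B + 1) * L) powr q) / L < 1"
    using eventually_happens'[OF trivial_limit_at_top_linorder] by blast
  have "C * (1 + (A + B * L) powr q) \<le> \<bar>C\<bar> * (1 + ((A + 1) + (B + 1) * L) powr q)"
    using assms L by (intro mult_mono add_left_mono powr_mono2 add_mono mult_right_mono) auto
  also have "\<dots> < L"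
    using L by (simp add: divide_less_eq)
  finally show ?thesis using L by blast
qed

section \<open>The symbol of a nonzero bounded almost multiplicative operator\<close>

locale besov_homomorphism =
  fixes p :: real and T :: "(complex \<Rightarrow> complex) \<Rightarrow> (complex \<Rightarrow> complex)"
  assumes p: "1 < p"
    and bounded: "bounded_linear_operator_on (besov_space p) (besov_norm p) T"
    and nonzero: "\<exists>f\<in>besov_space p. T f \<noteq> (\<lambda>z. 0)"
    and mult: "almost_multiplicative (besov_space p) T"
begin

abbreviation "one \<equiv> disc_restrict (\<lambda>_. 1)"

definition symb :: "complex \<Rightarrow> complex" where
  "symb = T (disc_restrict (\<lambda>z. z))"

lemma T_in: "f \<in> besov_space p \<Longrightarrow> T f \<in> besov_space p"
  using bounded by (auto simp: bounded_linear_operator_on_def)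

lemma T_add: "f \<in> besov_space p \<Longrightarrow> g \<in> besov_space p \<Longrightarrow> T (\<lambda>z. f z + g z) = (\<lambda>z. T f z + T g z)"
  using bounded by (auto simp: bounded_linear_operator_on_def)

lemma T_cmult: "f \<in> besov_space p \<Longrightarrow> T (\<lambda>z. c * f z) = (\<lambda>z. c * T f z)"
  using bounded by (auto simp: bounded_linear_operator_on_def)

lemma T_mult:
  "f \<in> besov_space p \<Longrightarrow> g \<in> besov_space p \<Longrightarrow> (\<lambda>z. f z * g z) \<in> besov_space p \<Longrightarrow>
    T (\<lambda>z. f z * g z) = (\<lambda>z. T f z * T g z)"
  using mult by (auto simp: almost_multiplicative_def)

lemma in_space: "R > 1 \<Longrightarrow> f holomorphic_on ball 0 R \<Longrightarrow> disc_restrict f \<in> besov_space p"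
  using disc_restrict_in_besov_space[OF p] .

lemma one_in: "one \<in> besov_space p" and id_in: "disc_restrict (\<lambda>z. z) \<in> besov_space p"
  by (auto intro!: in_space[of 2] holomorphic_intros)

text \<open>\<open>T one\<close> is idempotent, so its values lie in \<open>{0, 1}\<close> and it is
  constant on the connected disc. The constant 0 would give \<open>T f = T one * T f = 0\<close> for
  all \<open>f\<close>.\<close>

lemma T_one:
  assumes z: "z \<in> unit_disc"
  shows "T one z = 1"
proof -
  have hol: "T one holomorphic_on unit_disc"
    using besov_spaceD(1)[OF T_in[OF one_in]] .
  have "(\<lambda>z. one z * one z) = one"
    by (auto simp: disc_restrict_def)
  then have "T one = (\<lambda>z. T one z * T one z)"
    using T_mult[OF one_in one_in] one_in by simp
  then have "T one z = T one z * T one z" for z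
    by (rule fun_cong)
  then have vals: "T one z = 0 \<or> T one z = 1" for z
    by (metis mult_cancel_right1)
  then have "T one ` unit_disc \<subseteq> {0, 1}"
    by auto
  then have "finite (T one ` unit_disc)"
    by (rule finite_subset) simp
  then have "T one constant_on unit_disc"
    by (intro continuous_finite_range_constant holomorphic_on_imp_continuous_on hol) auto
  then obtain c where c: "\<And>z. z \<in> unit_disc \<Longrightarrow> T one z = c"
    unfolding constant_on_def by auto
  have "c \<noteq> 0"
  proof
    assume "c = 0"
    with c besov_spaceD(2)[OF T_in[OF one_in]] have 0: "T one z = 0" for z
      by (cases "z \<in> unit_disc") auto
    have "T f = (\<lambda>z. 0)" if f: "f \<in> besov_space p" for f
    proof -
      have "(\<lambda>z. one z * f z) = f"
        using besov_spaceD(2)[OF f] by (auto simp: disc_restrict_def)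
      then show ?thesis
        using T_mult[OF one_in f] f 0 by simp
    qed
    with nonzero show False by blast
  qed
  with vals[of z] c[OF z] show ?thesis by auto
qed

text \<open>Multiplicativity is applied to \<open>(id - a) * g = f - c\<close>, with constants
  realised as multiples of \<open>one\<close>. In every use \<open>a\<close> is the value
  \<open>symb l\<close>, so the right side vanishes and \<open>T f l = c\<close>.\<close>

lemma T_factor:
  assumes f: "f \<in> besov_space p" and g: "g \<in> besov_space p"
    and eq: "\<And>z. z \<in> unit_disc \<Longrightarrow> f z - c = (z - a) * g z"
    and l: "l \<in> unit_disc"
  shows "T f l - c = (symb l - a) * T g l"
proof -
  let ?u = "\<lambda>z. disc_restrict (\<lambda>z. z) z + (- a) * one z"
  let ?v = "\<lambda>z. f z + (- c) * one z"
  have u: "?u \<in> besov_space p" and v: "?v \<in> besov_space p"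
    by (rule besov_space_add_const[OF id_in], rule besov_space_add_const[OF f])
  have k: "(\<lambda>z. d * one z) \<in> besov_space p" for d
  proof -
    have "(\<lambda>z. d * one z) = disc_restrict (\<lambda>_. d)"
      by (auto simp: disc_restrict_def)
    then show ?thesis
      using in_space[of 2 "\<lambda>_. d"] by simp
  qed
  have "(\<lambda>z. ?u z * g z) = ?v"
  proof
    fix z show "?u z * g z = ?v z"
    proof (cases "z \<in> unit_disc")
      case True
      with eq[OF True] show ?thesis by simp
    qed (use besov_spaceD(2)[OF f] besov_spaceD(2)[OF g] in \<open>simp add: disc_restrict_def\<close>)
  qed
  then have "T ?v = (\<lambda>z. T ?u z * T g z)"
    using T_mult[OF u g] v by simp
  moreover have "T ?u l = symb l - a"
    using T_add[OF id_in k, of "- a"] T_cmult[OF one_in, of "- a"] T_one[OF l] by (simp add: symb_def)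
  moreover have "T ?v l = T f l - c"
    using T_add[OF f k, of "- c"] T_cmult[OF one_in, of "- c"] T_one[OF l] by simp
  ultimately show ?thesis
    by metis
qed

text \<open>A value \<open>a\<close> of modulus greater than one would make
  \<open>1 / (id - a)\<close> holomorphic beyond the closed disc, hence a member of the space, and
  \<open>T one l\<close> would be 0.\<close>

lemma symb_le:
  assumes l: "l \<in> unit_disc"
  shows "cmod (symb l) \<le> 1"
proof (rule ccontr)
  assume w: "\<not> cmod (symb l) \<le> 1"
  have g: "disc_restrict (\<lambda>z. 1 / (z - symb l)) \<in> besov_space p"
    using w by (intro in_space[of "cmod (symb l)"]) (auto intro!: holomorphic_intros)
  have "T one l - 0 = (symb l - symb l) * T (disc_restrict (\<lambda>z. 1 / (z - symb l))) l"
    using w by (intro T_factor[OF one_in g _ l]) auto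
  with T_one[OF l] show False by simp
qed

text \<open>If \<open>symb 0 = w\<close>, then \<open>T f 0 = f w = L\<close> for the test function
  \<open>f\<close> with \<open>e = exp (- L)\<close>. The norm dominates the modulus at 0, so
  \<open>L \<le> |C| * (1 + (A + B * L) powr (1 / p))\<close>, which fails for a suitable
  \<open>L\<close>.\<close>

lemma symb_not_boundary_constant:
  assumes w: "cmod w = 1"
  shows "\<exists>l\<in>unit_disc. symb l \<noteq> w"
proof (rule ccontr)
  assume "\<not> ?thesis"
  then have symb0: "symb 0 = w" by simp
  obtain C where C: "\<And>f. f \<in> besov_space p \<Longrightarrow> besov_norm p (T f) \<le> C * besov_norm p f"
    using bounded unfolding bounded_linear_operator_on_def by blast
  obtain A B where AB: "A \<ge> 0" "B \<ge> 0"
    and int: "\<forall>e. 0 < e \<and> e \<le> 1 / 2 \<longrightarrow>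
      (\<integral>\<^sup>+z. ennreal ((1 - (cmod z)\<^sup>2) powr (p - 2) * cmod (1 + of_real e - z) powr (-p)) \<partial>disc_area)
        \<le> ennreal (A + B * ln (1 / e))"
    using nn_integral_log_test_le[OF p] by blast
  obtain L where L: "L \<ge> 1" "\<bar>C\<bar> * (1 + (A + B * L) powr (1 / p)) < L"
    using affine_powr_less[OF AB, of "1 / p" "\<bar>C\<bar>"] p by auto
  define e where "e = exp (- L)"
  have "exp L \<ge> 2"
    using exp_ge_add_one_self[of L] L by linarith
  then have e: "0 < e" "e \<le> 1 / 2"
    by (simp_all add: e_def exp_minus field_simps)
  have Le: "ln (1 / e) = L"
    by (simp add: e_def ln_div)
  define f where "f = (\<lambda>z. - Ln (1 + of_real e - cnj w * z))"
  have re: "Re (1 + of_real e - cnj w * z) > 0" if "z \<in> ball 0 (1 + e)" for z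
  proof -
    have "Re (cnj w * z) \<le> cmod z"
      using complex_Re_le_cmod[of "cnj w * z"] w by (simp add: norm_mult)
    also have "\<dots> < 1 + e" using that by simp
    finally show ?thesis by simp
  qed
  have nr: "1 + of_real e - cnj w * z \<notin> \<real>\<^sub>\<le>\<^sub>0" if "z \<in> ball 0 (1 + e)" for z
    using re[OF that] complex_nonpos_Reals_iff by force
  have holf: "f holomorphic_on ball 0 (1 + e)"
    unfolding f_def using nr by (intro holomorphic_intros) auto
  \<comment> \<open>Here the base point lies on the unit circle, but \<open>f\<close> is holomorphic
    on a larger disc containing \<open>w\<close>; hence so is the quotient, and its restriction is
    in the space.\<close>
  define g where "g = (\<lambda>z. if z = w then deriv f w else (f z - f w) / (z - w))"
  have holg: "g holomorphic_on ball 0 (1 + e)"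
    unfolding g_def by (rule pole_lemma_open[OF holf]) simp
  have f: "disc_restrict f \<in> besov_space p" and g: "disc_restrict g \<in> besov_space p"
    using e by (auto intro!: in_space[of "1 + e"] holf holg)
  have "T (disc_restrict f) 0 - f w = (symb 0 - w) * T (disc_restrict g) 0"
  proof (rule T_factor[OF f g])
    fix z :: complex assume "z \<in> unit_disc"
    moreover from this w have "z \<noteq> w" by auto
    ultimately show "disc_restrict f z - f w = (z - w) * disc_restrict g z"
      by (simp add: g_def)
  qed simp
  then have "T (disc_restrict f) 0 = f w"
    by (simp add: symb0)
  also have "cnj w * w = 1"
    using w complex_norm_square[of w] by (simp add: mult.commute)
  then have "f w = - Ln (of_real e)"
    by (simp add: f_def)
  also have "\<dots> = of_real L"
    using e by (simp add: Ln_of_real e_def)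
  finally have "L = cmod (T (disc_restrict f) 0)"
    using L by simp
  also have "\<dots> \<le> besov_norm p (T (disc_restrict f))"
    by (simp add: besov_norm_def)
  also have "\<dots> \<le> C * besov_norm p (disc_restrict f)"
    by (rule C[OF f])
  also have "\<dots> \<le> \<bar>C\<bar> * (1 + (A + B * L) powr (1 / p))"
  proof (rule mult_mono)
    have "Ln (1 + of_real e) = of_real (ln (1 + e))"
      using e Ln_of_real[of "1 + e"] by simp
    then have "cmod (disc_restrict f 0) = \<bar>ln (1 + e)\<bar>"
      by (simp add: f_def)
    also have "\<dots> \<le> 1"
      using ln_add_one_self_le_self[of e] e by simp
    finally have 1: "cmod (disc_restrict f 0) \<le> 1" .
    have d: "besov_integrand p (disc_restrict f) z
        = (1 - (cmod z)\<^sup>2) powr (p - 2) * cmod (1 + of_real e - cnj w * z) powr (-p)" if z: "z \<in> unit_disc" for z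
    proof -
      have zb: "z \<in> ball 0 (1 + e)" using z e by auto
      have "(f has_field_derivative cnj w / (1 + of_real e - cnj w * z)) (at z)"
        unfolding f_def using nr[OF zb] re[OF zb]
        by (auto intro!: derivative_eq_intros simp: field_simps)
      then have "deriv (disc_restrict f) z = cnj w / (1 + of_real e - cnj w * z)"
        using deriv_eq_on_unit_disc[of "disc_restrict f" f z] z by (simp add: DERIV_imp_deriv)
      then show ?thesis
        using w by (simp add: besov_integrand_def norm_divide powr_divide powr_minus_divide)
    qed
    \<comment> \<open>Since \<open>|cnj w * z| = |z|\<close>, the integrand is a function of
      \<open>cnj w * z\<close>; a rotation moves the boundary point \<open>w\<close> to 1, where the
      estimate was made.\<close>
    have "(\<integral>\<^sup>+z. ennreal (besov_integrand p (disc_restrict f) z) \<partial>disc_area)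
        = (\<integral>\<^sup>+z. ennreal ((1 - (cmod (cnj w * z))\<^sup>2) powr (p - 2) * cmod (1 + of_real e - cnj w * z) powr (-p)) \<partial>disc_area)"
      by (rule nn_integral_cong_AE) (use AE_disc_area in \<open>eventually_elim, simp add: d norm_mult w\<close>)
    also have "\<dots> = (\<integral>\<^sup>+z. ennreal ((1 - (cmod z)\<^sup>2) powr (p - 2) * cmod (1 + of_real e - z) powr (-p)) \<partial>disc_area)"
      using w by (intro nn_integral_disc_area_rotate) auto
    also have "\<dots> \<le> ennreal (A + B * L)"
      using int e by (simp only: Le[symmetric])
    finally have "(\<integral>z. besov_integrand p (disc_restrict f) z \<partial>disc_area) \<le> A + B * L"
      using AB L by (intro integral_real_bounded) auto
    then have "(\<integral>z. besov_integrand p (disc_restrict f) z \<partial>disc_area) powr (1 / p) \<le> (A + B * L) powr (1 / p)"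
      using p by (intro powr_mono2) (auto intro!: integral_nonneg simp: besov_integrand_def)
    with 1 show "besov_norm p (disc_restrict f) \<le> 1 + (A + B * L) powr (1 / p)"
      unfolding besov_norm_def by (rule add_mono)
  qed (auto simp: besov_norm_def)
  finally show False using L by simp
qed

lemma symb_in_unit_disc:
  assumes l: "l \<in> unit_disc"
  shows "symb l \<in> unit_disc"
proof (rule ccontr)
  assume "symb l \<notin> unit_disc"
  with symb_le[OF l] have 1: "cmod (symb l) = 1" by simp
  have "symb constant_on unit_disc"
  proof (rule maximum_modulus_principle[where U = unit_disc and \<xi> = l])
    show "symb holomorphic_on unit_disc"
      unfolding symb_def using besov_spaceD(1)[OF T_in[OF id_in]] .
  qed (use l symb_le 1 in auto)
  then have "\<forall>z\<in>unit_disc. symb z = symb l"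
    using l unfolding constant_on_def by auto
  with symb_not_boundary_constant[OF 1] show False by blast
qed

text \<open>At each \<open>l\<close> the factorization with the difference quotient of
  \<open>f\<close> at \<open>symb l\<close> gives \<open>T f l = f (symb l)\<close>. That quotient
  is in the space because \<open>symb l\<close> has been shown to lie in the open disc.\<close>

lemma composition: "composition_operator (besov_space p) T"
  unfolding composition_operator_def
proof (intro exI conjI ballI)
  show "symb holomorphic_on unit_disc"
    unfolding symb_def using besov_spaceD(1)[OF T_in[OF id_in]] .
  show "symb \<in> unit_disc \<rightarrow> unit_disc"
    using symb_in_unit_disc by blast
  fix f and l :: complex assume f: "f \<in> besov_space p" and l: "l \<in> unit_disc"
  obtain g where g: "g \<in> besov_space p" "\<And>z. z \<in> unit_disc \<Longrightarrow> f z - f (symb l) = (z - symb l) * g z"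
    using besov_difference_quotient[OF f p symb_in_unit_disc[OF l]] by blast
  from T_factor[OF f g l] show "T f l = f (symb l)"
    by simp
qed

end

theorem theorem3p3:
  fixes p :: real and T :: "(complex \<Rightarrow> complex) \<Rightarrow> (complex \<Rightarrow> complex)"
  assumes "1 < p"
    and "bounded_linear_operator_on (besov_space p) (besov_norm p) T"
    and "\<exists>f\<in>besov_space p. T f \<noteq> (\<lambda>z. 0)"
  shows "almost_multiplicative (besov_space p) T \<longleftrightarrow> composition_operator (besov_space p) T"
proof
  assume "almost_multiplicative (besov_space p) T"
  with assms interpret besov_homomorphism p T
    by unfold_locales
  show "composition_operator (besov_space p) T"
    by (rule composition)
next
  assume "composition_operator (besov_space p) T"
  then obtain \<phi> where \<phi>: "\<And>f z. f \<in> besov_space p \<Longrightarrow> z \<in> unit_disc \<Longrightarrow> T f z = f (\<phi> z)"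
    unfolding composition_operator_def by auto
  have T_in: "T f \<in> besov_space p" if "f \<in> besov_space p" for f
    using assms(2) that by (auto simp: bounded_linear_operator_on_def)
  show "almost_multiplicative (besov_space p) T"
    unfolding almost_multiplicative_def
  proof (intro ballI impI ext)
    \<comment> \<open>Equality of total functions is required: on the disc it is that of
      compositions, and off the disc both sides vanish because images under \<open>T\<close> are
      again representatives.\<close>
    fix f g z assume "f \<in> besov_space p" "g \<in> besov_space p" "(\<lambda>z. f z * g z) \<in> besov_space p"
    then show "T (\<lambda>z. f z * g z) z = T f z * T g z"
      using \<phi> besov_spaceD(2)[OF T_in] by (cases "z \<in> unit_disc") auto
  qed
qed

end
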